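(* Let $\gamma>1$ and let $U=(u_1,u_2)\in X$ be any energy minimizing solution of $$-u_1''+(u_1^2+\gamma u_2^2-1)u_1=0,\qquad -u_2''+(\gamma u_1^2+u_2^2-1)u_2=0\qquad(x\in\mathbb{R}).$$ Assume that $\lambda=0$ is an isolated, simple eigenvalue of $L_+$. Then there exists $\eta_0>0$ such that if $V=(v_1,v_2)\in X$ is any other solution of the same system, then either $$\inf_{\tau\in\mathbb{R}}\|U(\cdot)-V(\cdot-\tau)\|_{L^2}\ge\eta_0,$$ or there exists $\tau\in\mathbb{R}$ such that $V(x-\tau)=U(x)$ for all $x\in\mathbb{R}$.
   Context: $X$ is the set of $U\in H^1_{loc}(\mathbb{R};\mathbb{R}^2)$ with $U(x)\to(1,0)$ as $x\to+\infty$ and $U(x)\to(0,1)$ as $x\to-\infty$. The energy is $E(\Psi)=\frac12\int_{-\infty}^\infty\bigl(|\psi_1'|^2+|\psi_2'|^2+\frac12(|\psi_1|^2+|\psi_2|^2-1)^2+(\gamma-1)|\psi_1|^2|\psi_2|^2\bigr)dx$, and energy minimizing means $E(U)=\inf_XE$. The operator $L_+$, self-adjoint in $L^2(\mathbb{R};\mathbb{R}^2)$, is $$L_+=\begin{pmatrix}-\partial_x^2+3u_1^2+\gamma u_2^2-1&2\gamma u_1u_2\\2\gamma u_1u_2&-\partial_x^2+\gamma u_1^2+3u_2^2-1\end{pmatrix}.$$ *)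

theory Defs
  imports "HOL-Analysis.Analysis"
begin

(* Classes modulo null sets are represented by Borel measurable functions;
   equality in L^2 is ae_eq. *)

definition ae_eq :: "(real \<Rightarrow> 'a::euclidean_space) \<Rightarrow> (real \<Rightarrow> 'a) \<Rightarrow> bool" where
  "ae_eq f g \<longleftrightarrow> (AE x in lborel. f x = g x)"

definition L2 :: "(real \<Rightarrow> 'a::euclidean_space) set" where
  "L2 = {f \<in> borel_measurable lborel. integrable lborel (\<lambda>x. (norm (f x))\<^sup>2)}"

definition L2_loc :: "(real \<Rightarrow> 'a::euclidean_space) set" where
  "L2_loc = {f \<in> borel_measurable lborel.
     \<forall>a b. set_integrable lborel {a..b} (\<lambda>x. (norm (f x))\<^sup>2)}"

(* Extended-valued, so that the norm of a function outside L^2 is infinite. *)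
definition norm_L2 :: "(real \<Rightarrow> 'a::euclidean_space) \<Rightarrow> ennreal" where
  "norm_L2 f = (let I = \<integral>\<^sup>+ x. ennreal ((norm (f x))\<^sup>2) \<partial>lborel in
     if I = \<infinity> then \<infinity> else ennreal (sqrt (enn2real I)))"

definition test_function :: "(real \<Rightarrow> real) \<Rightarrow> bool" where
  "test_function \<phi> \<longleftrightarrow>
     (\<forall>n x. (deriv ^^ n) \<phi> differentiable (at x)) \<and> compact (closure {x. \<phi> x \<noteq> 0})"

definition locally_integrable :: "(real \<Rightarrow> 'a::euclidean_space) \<Rightarrow> bool" where
  "locally_integrable f \<longleftrightarrow> (\<forall>a b. set_integrable lborel {a..b} f)"

definition has_weak_deriv ::
    "(real \<Rightarrow> 'a::euclidean_space) \<Rightarrow> (real \<Rightarrow> 'a) \<Rightarrow> bool" (infix \<open>has'_weak'_deriv\<close> 50) where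
  "f has_weak_deriv g \<longleftrightarrow> locally_integrable f \<and> locally_integrable g \<and>
     (\<forall>\<phi>. test_function \<phi> \<longrightarrow>
        (LINT x|lborel. deriv \<phi> x *\<^sub>R f x) = - (LINT x|lborel. \<phi> x *\<^sub>R g x))"

(* Only determined up to ae_eq, and meaningful only if a weak derivative exists. *)
definition weak_deriv :: "(real \<Rightarrow> 'a::euclidean_space) \<Rightarrow> real \<Rightarrow> 'a" where
  "weak_deriv f = (SOME g. f has_weak_deriv g)"

definition H1_loc :: "(real \<Rightarrow> 'a::euclidean_space) set" where
  "H1_loc = {f \<in> L2_loc. \<exists>g\<in>L2_loc. f has_weak_deriv g}"

definition H2 :: "(real \<Rightarrow> 'a::euclidean_space) set" where
  "H2 = {f \<in> L2. \<exists>g\<in>L2. \<exists>h\<in>L2. f has_weak_deriv g \<and> g has_weak_deriv h}"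

(* As the limits at infinity are pointwise, an element of H^1_loc is represented
   here by its continuous representative. *)
definition X_space :: "(real \<Rightarrow> real \<times> real) set" where
  "X_space = {U \<in> H1_loc. continuous_on UNIV U \<and>
     (U \<longlongrightarrow> (1, 0)) at_top \<and> (U \<longlongrightarrow> (0, 1)) at_bot}"

(* For gamma \<ge> 1 the density is nonnegative, so ennreal does not truncate it. *)
definition energy :: "real \<Rightarrow> (real \<Rightarrow> real \<times> real) \<Rightarrow> ennreal" where
  "energy \<gamma> \<Psi> = (\<integral>\<^sup>+ x. ennreal (1/2 *
     ((fst (weak_deriv \<Psi> x))\<^sup>2 + (snd (weak_deriv \<Psi> x))\<^sup>2
      + 1/2 * ((fst (\<Psi> x))\<^sup>2 + (snd (\<Psi> x))\<^sup>2 - 1)\<^sup>2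
      + (\<gamma> - 1) * (fst (\<Psi> x))\<^sup>2 * (snd (\<Psi> x))\<^sup>2)) \<partial>lborel)"

definition energy_minimizing :: "real \<Rightarrow> (real \<Rightarrow> real \<times> real) \<Rightarrow> bool" where
  "energy_minimizing \<gamma> U \<longleftrightarrow> U \<in> X_space \<and> energy \<gamma> U = (INF \<Psi>\<in>X_space. energy \<gamma> \<Psi>)"

definition is_solution :: "real \<Rightarrow> (real \<Rightarrow> real \<times> real) \<Rightarrow> bool" where
  "is_solution \<gamma> U \<longleftrightarrow> (\<exists>U' U''. \<forall>x.
     (U has_vector_derivative U' x) (at x) \<and> (U' has_vector_derivative U'' x) (at x) \<and>
     - fst (U'' x) + ((fst (U x))\<^sup>2 + \<gamma> * (snd (U x))\<^sup>2 - 1) * fst (U x) = 0 \<and>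
     - snd (U'' x) + (\<gamma> * (fst (U x))\<^sup>2 + (snd (U x))\<^sup>2 - 1) * snd (U x) = 0)"

(* The self-adjoint realization in L^2 has domain H2; the values on other functions
   are irrelevant. *)
definition L_plus ::
    "real \<Rightarrow> (real \<Rightarrow> real \<times> real) \<Rightarrow> (real \<Rightarrow> real \<times> real) \<Rightarrow> real \<Rightarrow> real \<times> real" where
  "L_plus \<gamma> U W = (\<lambda>x.
     let u1 = fst (U x); u2 = snd (U x); w1 = fst (W x); w2 = snd (W x);
         W'' = weak_deriv (weak_deriv W) x
     in (- fst W'' + (3 * u1\<^sup>2 + \<gamma> * u2\<^sup>2 - 1) * w1 + 2 * \<gamma> * u1 * u2 * w2,
         - snd W'' + 2 * \<gamma> * u1 * u2 * w1 + (\<gamma> * u1\<^sup>2 + 3 * u2\<^sup>2 - 1) * w2))"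

(* Real resolvent set and spectrum of an operator T in L^2 with domain D:
   T - \<mu> is a bijection from D onto L^2 (modulo null sets) with bounded inverse.
   Real \<mu> suffice, since the spectrum of a self-adjoint operator is real. *)

definition resolvent_set ::
    "(real \<Rightarrow> 'a::euclidean_space) set \<Rightarrow> ((real \<Rightarrow> 'a) \<Rightarrow> real \<Rightarrow> 'a) \<Rightarrow> real set" where
  "resolvent_set D T = {\<mu>.
     (\<forall>F\<in>L2. \<exists>W\<in>D. ae_eq (\<lambda>x. T W x - \<mu> *\<^sub>R W x) F \<and>
        (\<forall>Z\<in>D. ae_eq (\<lambda>x. T Z x - \<mu> *\<^sub>R Z x) F \<longrightarrow> ae_eq Z W)) \<and>
     (\<exists>C::real. \<forall>W\<in>D. norm_L2 W \<le> ennreal C * norm_L2 (\<lambda>x. T W x - \<mu> *\<^sub>R W x))}"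

definition spectrum ::
    "(real \<Rightarrow> 'a::euclidean_space) set \<Rightarrow> ((real \<Rightarrow> 'a) \<Rightarrow> real \<Rightarrow> 'a) \<Rightarrow> real set" where
  "spectrum D T = - resolvent_set D T"

(* The eigenspace is one-dimensional; for self-adjoint operators the algebraic and
   geometric multiplicities agree. *)
definition simple_eigenvalue ::
    "(real \<Rightarrow> 'a::euclidean_space) set \<Rightarrow> ((real \<Rightarrow> 'a) \<Rightarrow> real \<Rightarrow> 'a) \<Rightarrow> real \<Rightarrow> bool" where
  "simple_eigenvalue D T \<mu> \<longleftrightarrow>
     (\<exists>W\<in>D. \<not> ae_eq W (\<lambda>x. 0) \<and> ae_eq (T W) (\<lambda>x. \<mu> *\<^sub>R W x) \<and>
        (\<forall>Z\<in>D. ae_eq (T Z) (\<lambda>x. \<mu> *\<^sub>R Z x) \<longrightarrow> (\<exists>c. ae_eq Z (\<lambda>x. c *\<^sub>R W x))))"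

end

theory Submission
  imports Defs
begin

text \<open>
  Write the system as \<open>U'' = f(U)\<close>. If the claim fails, there are solutions \<open>V\<close> arbitrarily close
  to \<open>U\<close> in \<open>L\<^sup>2\<close>, up to translation, that are not translates of \<open>U\<close>. All solutions in \<open>X\<close> obey
  \<open>|V| \<le> 1\<close> by the maximum principle, hence are uniformly Lipschitz, and so \<open>L\<^sup>2\<close>-closeness implies uniform
  closeness. Fix \<open>x\<^sub>0\<close> with \<open>U'(x\<^sub>0) \<noteq> 0\<close>; by the intermediate value theorem a further small translation
  makes \<open>W = V - U\<close> satisfy \<open>W(x\<^sub>0) \<bullet> U'(x\<^sub>0) = 0\<close>. Since \<open>L\<^sub>+ W = O(|W|\<^sup>2)\<close> and the potential of \<open>L\<^sub>+\<close> is
  positive definite near \<open>\<plusminus>\<infinity>\<close>, the function \<open>|W|\<^sup>2\<close> decays exponentially outside a fixed compact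
  interval, so \<open>|W|\<close> attains its supremum there. Normalising by the supremum and passing to a limit
  yields a nonzero bounded solution \<open>Z\<close> of \<open>L\<^sub>+ Z = 0\<close> with \<open>Z(x\<^sub>0) \<bullet> U'(x\<^sub>0) = 0\<close>. It decays exponentially,
  so it lies in the kernel of \<open>L\<^sub>+\<close>, which is spanned by \<open>U'\<close>; hence \<open>Z = 0\<close>, a contradiction.
\<close>

subsection \<open>Weak derivatives of smooth functions\<close>

text \<open>The exponent \<open>k\<close> closes the family under differentiation up to linear
  combinations, so smoothness of the standard flat function \<open>flat_exp 0\<close> rests on a
  single derivative formula.\<close>

definition flat_exp :: "nat \<Rightarrow> real \<Rightarrow> real" where
  "flat_exp k x = (if x \<le> 0 then 0 else exp (- (1 / x)) / x ^ k)"

text \<open>With y = 1/x the limit from the right is that of y^k exp(-y) at infinity.\<close>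

lemma flat_exp_tendsto_0: "(flat_exp k \<longlongrightarrow> 0) (at 0)"
proof -
  have "((\<lambda>x::real. (inverse x) ^ k / exp (inverse x)) \<longlongrightarrow> 0) (at_right 0)"
    using tendsto_power_div_exp_0 filterlim_inverse_at_top_right by (rule filterlim_compose)
  then have "(flat_exp k \<longlongrightarrow> 0) (at_right 0)"
    by (rule Lim_transform_eventually)
      (auto simp: flat_exp_def eventually_at_filter exp_minus field_simps power_inverse)
  moreover have "(flat_exp k \<longlongrightarrow> 0) (at_left 0)"
    by (rule tendsto_eventually) (auto simp: flat_exp_def eventually_at_filter)
  ultimately show ?thesis
    by (simp add: filterlim_split_at)
qed

lemma DERIV_flat_exp:
  "(flat_exp k has_real_derivative flat_exp (k + 2) x - k * flat_exp (k + 1) x) (at x)"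
proof -
  consider "x < 0" | "x = 0" | "x > 0" by linarith
  then show ?thesis
  proof cases
    case 1
    have "((\<lambda>x. 0) has_real_derivative 0) (at x)" by simp
    then have "(flat_exp k has_real_derivative 0) (at x)"
      by (rule DERIV_cong_ev[THEN iffD1, rotated -1])
        (use 1 in \<open>auto simp: flat_exp_def intro!: eventually_mono[OF eventually_nhds_in_open[of "{..<0}"]]\<close>)
    then show ?thesis using 1 by (simp add: flat_exp_def)
  next
    case 2
    \<comment> \<open>Dividing by \<open>h\<close> raises the exponent by one: for
      \<open>h \<noteq> 0\<close> the difference quotient at 0 is
      \<open>flat_exp (Suc k) h\<close>.\<close>
    have "((\<lambda>h. (flat_exp k (0 + h) - flat_exp k 0) / h) \<longlongrightarrow> 0) (at 0)"
      by (rule Lim_transform_eventually[OF flat_exp_tendsto_0[of "Suc k"]])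
        (auto simp: flat_exp_def field_simps eventually_at_filter)
    then show ?thesis using 2 by (simp add: DERIV_def flat_exp_def)
  next
    case 3
    have "((\<lambda>x. exp (- (1 / x)) / x ^ k) has_real_derivative
        (exp (- (1 / x)) * (1 / x\<^sup>2) * x ^ k - exp (- (1 / x)) * (k * x ^ (k - 1))) / (x ^ k)\<^sup>2) (at x)"
      using 3 by (auto intro!: derivative_eq_intros simp: power2_eq_square)
    moreover have "(exp (- (1 / x)) * (1 / x\<^sup>2) * x ^ k - exp (- (1 / x)) * (k * x ^ (k - 1))) / (x ^ k)\<^sup>2
        = flat_exp (k + 2) x - k * flat_exp (k + 1) x"
      using 3 by (cases k) (auto simp: flat_exp_def field_simps power2_eq_square)
    ultimately have "((\<lambda>x. exp (- (1 / x)) / x ^ k) has_real_derivative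
        flat_exp (k + 2) x - k * flat_exp (k + 1) x) (at x)" by simp
    then show ?thesis
      by (rule DERIV_cong_ev[THEN iffD1, rotated -1])
        (use 3 in \<open>auto simp: flat_exp_def intro!: eventually_mono[OF eventually_nhds_in_open[of "{0<..}"]]\<close>)
  qed
qed

text \<open>For \<open>c > 0\<close> the generators vanish outside the interval from
  \<open>a\<close> to \<open>b\<close>. Their linear span contains the bump functions below and is
  stable under \<open>deriv\<close>, which gives derivatives of all orders by induction.\<close>

inductive_set flat_span :: "real \<Rightarrow> real \<Rightarrow> real \<Rightarrow> (real \<Rightarrow> real) set" for c a b where
  base: "(\<lambda>x. flat_exp i (c * (x - a)) * flat_exp j (c * (b - x))) \<in> flat_span c a b"
| add: "f \<in> flat_span c a b \<Longrightarrow> g \<in> flat_span c a b \<Longrightarrow> (\<lambda>x. f x + g x) \<in> flat_span c a b"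
| scale: "f \<in> flat_span c a b \<Longrightarrow> (\<lambda>x. r * f x) \<in> flat_span c a b"

lemma flat_span_deriv:
  assumes "f \<in> flat_span c a b"
  shows "\<exists>g\<in>flat_span c a b. \<forall>x. (f has_real_derivative g x) (at x)"
  using assms
proof induction
  case (base i j)
  let ?h = "\<lambda>i j x. flat_exp i (c * (x - a)) * flat_exp j (c * (b - x))"
  \<comment> \<open>Product rule: the chain rule brings out \<open>c\<close> from the first factor
    and \<open>- c\<close> from the second, whose argument runs backwards.\<close>
  let ?g = "\<lambda>x. (c * ?h (i + 2) j x + (- c * i) * ?h (i + 1) j x)
      + ((- c) * ?h i (j + 2) x + (c * j) * ?h i (j + 1) x)"
  have "?g \<in> flat_span c a b"
    by (intro flat_span.intros)
  moreover have "(?h i j has_real_derivative ?g x) (at x)" for x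
    by (rule derivative_eq_intros DERIV_chain'[OF _ DERIV_flat_exp] refl)+ (simp add: algebra_simps)
  ultimately show ?case by (intro bexI[of _ ?g] allI)
next
  case (add f g)
  then obtain f' g' where "f' \<in> flat_span c a b" "g' \<in> flat_span c a b"
    "\<forall>x. (f has_real_derivative f' x) (at x)" "\<forall>x. (g has_real_derivative g' x) (at x)" by blast
  then show ?case
    by (intro bexI[of _ "\<lambda>x. f' x + g' x"]) (auto intro!: flat_span.add derivative_eq_intros)
next
  case (scale f r)
  then obtain f' where "f' \<in> flat_span c a b"
    "\<forall>x. (f has_real_derivative f' x) (at x)" by blast
  then show ?case
    by (intro bexI[of _ "\<lambda>x. r * f' x"]) (auto intro!: flat_span.scale derivative_eq_intros)
qed

lemma flat_span_iterated_deriv: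
  assumes "f \<in> flat_span c a b"
  shows "(deriv ^^ n) f \<in> flat_span c a b"
proof (induction n)
  case (Suc n)
  from flat_span_deriv[OF this] obtain g where g: "g \<in> flat_span c a b"
    "\<forall>x. ((deriv ^^ n) f has_real_derivative g x) (at x)" by blast
  then have "deriv ((deriv ^^ n) f) = g"
    by (auto intro!: DERIV_imp_deriv)
  with g show ?case by simp
qed (use assms in simp)

text \<open>As \<open>n\<close> grows, these increase to the indicator of \<open>(a, b)\<close>, so no normalisation is needed.\<close>

definition bump :: "real \<Rightarrow> real \<Rightarrow> nat \<Rightarrow> real \<Rightarrow> real" where
  "bump a b n x = flat_exp 0 (n * (x - a)) * flat_exp 0 (n * (b - x))"

lemma bump_eq_0: "x \<notin> {a..b} \<Longrightarrow> bump a b n x = 0"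
  unfolding bump_def flat_exp_def
  by (auto simp: mult_nonneg_nonpos)

lemma test_function_bump: "test_function (bump a b n)"
proof -
  have *: "bump a b n \<in> flat_span (real n) a b"
    unfolding bump_def by (rule flat_span.base)
  have "(deriv ^^ m) (bump a b n) differentiable (at x)" for m x
    using flat_span_deriv[OF flat_span_iterated_deriv[OF *, of m]]
    by (metis real_differentiable_def)
  moreover have "{x. bump a b n x \<noteq> 0} \<subseteq> {a..b}"
    using bump_eq_0 by blast
  then have "compact (closure {x. bump a b n x \<noteq> 0})"
    unfolding compact_closure by (rule bounded_subset[OF bounded_closed_interval])
  ultimately show ?thesis by (auto simp: test_function_def)
qed

lemma flat_exp_0_bounds: "0 \<le> flat_exp 0 x" "flat_exp 0 x \<le> 1"
  by (auto simp: flat_exp_def)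

lemma bump_bounds: "0 \<le> bump a b n x" "bump a b n x \<le> indicator {a..b} x"
proof -
  show "0 \<le> bump a b n x" by (simp add: bump_def flat_exp_0_bounds)
  show "bump a b n x \<le> indicator {a..b} x"
    using bump_eq_0[of x a b n] by (cases "x \<in> {a..b}") (auto simp: bump_def mult_le_one flat_exp_0_bounds)
qed

lemma flat_exp_0_tendsto:
  "(\<lambda>n. flat_exp 0 (real n * y)) \<longlonglongrightarrow> indicator {0<..} y"
proof (cases "y > 0")
  case True
  have "(\<lambda>n. exp (- (1 / (real n * y)))) \<longlonglongrightarrow> exp (- 0)"
    by (intro tendsto_intros real_tendsto_divide_at_top[OF tendsto_const]
        filterlim_at_top_mult_tendsto_pos[OF tendsto_const True] filterlim_real_sequentially)
  \<comment> \<open>The two sequences agree only from index 1 on: at \<open>n = 0\<close> the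
    argument is 0, where \<open>flat_exp 0\<close> is 0, whereas the exponential is 1 because
    \<open>1 / 0 = 0\<close>.\<close>
  then have "(\<lambda>n. flat_exp 0 (real n * y)) \<longlonglongrightarrow> 1"
    unfolding minus_zero exp_zero by (rule Lim_transform_eventually)
      (use True in \<open>auto simp: flat_exp_def mult_le_0_iff intro!: eventually_sequentiallyI[of 1]\<close>)
  then show ?thesis using True by simp
next
  case False
  then show ?thesis by (auto simp: flat_exp_def mult_le_0_iff zero_less_mult_iff)
qed

lemma bump_tendsto: "(\<lambda>n. bump a b n x) \<longlonglongrightarrow> indicator {a<..<b} x"
proof -
  have "(\<lambda>n. bump a b n x) \<longlonglongrightarrow> indicator {0<..} (x - a) * indicator {0<..} (b - x)"
    unfolding bump_def by (intro tendsto_intros flat_exp_0_tendsto)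
  also have "indicator {0<..} (x - a) * indicator {0<..} (b - x) = (indicator {a<..<b} x :: real)"
    by (auto simp: indicator_def)
  finally show ?thesis .
qed

section \<open>Test functions and the fundamental lemma of the calculus of variations\<close>

lemma test_function_deriv:
  assumes "test_function \<phi>"
  shows "(\<phi> has_real_derivative deriv \<phi> x) (at x)" "continuous_on UNIV \<phi>" "continuous_on UNIV (deriv \<phi>)"
proof -
  have 1: "\<phi> differentiable (at x)" "deriv \<phi> differentiable (at x)" for x
    using assms spec[of "\<lambda>n. \<forall>x. (deriv ^^ n) \<phi> differentiable (at x)" 0]
      spec[of "\<lambda>n. \<forall>x. (deriv ^^ n) \<phi> differentiable (at x)" 1]
    unfolding test_function_def by auto
  then show "(\<phi> has_real_derivative deriv \<phi> x) (at x)"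
    using DERIV_deriv_iff_real_differentiable by blast
  show "continuous_on UNIV \<phi>" "continuous_on UNIV (deriv \<phi>)"
    using 1 by (auto intro!: continuous_at_imp_continuous_on differentiable_imp_continuous_within)
qed

lemma test_function_support:
  assumes "test_function \<phi>"
  obtains T where "T > 0" "\<And>x. \<bar>x\<bar> \<ge> T \<Longrightarrow> \<phi> x = 0" "\<And>x. \<bar>x\<bar> \<ge> T \<Longrightarrow> deriv \<phi> x = 0"
proof -
  have "bounded {x. \<phi> x \<noteq> 0}"
    using assms compact_imp_bounded bounded_subset closure_subset unfolding test_function_def by metis
  then obtain S where S: "S > 0" "\<And>x. \<phi> x \<noteq> 0 \<Longrightarrow> \<bar>x\<bar> \<le> S"
    unfolding bounded_pos by auto
  then have \<phi>0: "\<phi> x = 0" if "\<bar>x\<bar> > S" for x using that leD by blast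
  \<comment> \<open>The derivative vanishes because \<open>\<phi>\<close> is 0 near \<open>x\<close>
    and not only at \<open>x\<close>; the margin 1 puts \<open>x\<close> into the open complement of
    \<open>{-S..S}\<close>.\<close>
  have "deriv \<phi> x = 0" if "\<bar>x\<bar> \<ge> S + 1" for x
  proof -
    have "eventually (\<lambda>y. y \<in> - {-S..S}) (nhds x)"
      using that S(1) by (intro eventually_nhds_in_open) auto
    then have "eventually (\<lambda>y. \<phi> y = 0) (nhds x)"
      by eventually_elim (auto intro!: \<phi>0)
    then have "deriv \<phi> x = deriv (\<lambda>_. 0) x" by (intro deriv_cong_ev) auto
    then show ?thesis by simp
  qed
  then show ?thesis using S(1) \<phi>0 by (intro that[of "S + 1"]) auto
qed

text \<open>Local integrability controls only the restrictions to compact intervals;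
  \<open>k\<close> is the pointwise limit of its truncations to \<open>{- n..n}\<close>.\<close>

lemma locally_integrable_measurable:
  assumes "locally_integrable k"
  shows "k \<in> borel_measurable lborel"
proof (rule borel_measurable_LIMSEQ_metric)
  show "(\<lambda>x. indicator {- real n..real n} x *\<^sub>R k x) \<in> borel_measurable lborel" for n
    using assms unfolding locally_integrable_def set_integrable_def by (blast intro: borel_measurable_integrable)
  show "(\<lambda>n. indicator {- real n..real n} x *\<^sub>R k x) \<longlonglongrightarrow> k x" for x
  proof (rule tendsto_eventually)
    obtain N where "\<bar>x\<bar> \<le> real N" using real_arch_simple by blast
    show "\<forall>\<^sub>F n in sequentially. indicator {- real n..real n} x *\<^sub>R k x = k x"
    proof (rule eventually_sequentiallyI)
      fix n assume "n \<ge> N"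
      then have "real N \<le> real n" by simp
      with \<open>\<bar>x\<bar> \<le> real N\<close> have "x \<in> {- real n..real n}" by auto
      then show "indicator {- real n..real n} x *\<^sub>R k x = k x" by simp
    qed
  qed
qed

lemma integrable_test_function_scaleR:
  assumes "test_function \<phi>" "locally_integrable k"
  shows "integrable lborel (\<lambda>x. \<phi> x *\<^sub>R k x)"
proof -
  from test_function_support[OF assms(1)] obtain T where T: "T > 0" "\<And>x. \<bar>x\<bar> \<ge> T \<Longrightarrow> \<phi> x = 0" by metis
  have [measurable]: "k \<in> borel_measurable borel" "\<phi> \<in> borel_measurable borel"
    using locally_integrable_measurable[OF assms(2)] test_function_deriv(2)[OF assms(1)]
    by (auto intro: borel_measurable_continuous_onI)
  have "continuous_on {-T..T} \<phi>"
    using test_function_deriv(2)[OF assms(1)] continuous_on_subset by blast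
  then obtain B where B: "\<And>x. x \<in> {-T..T} \<Longrightarrow> norm (\<phi> x) \<le> B"
    using compact_continuous_image[of "{-T..T}" \<phi>] compact_imp_bounded
    by (metis bounded_iff compact_Icc imageI)
  have "integrable lborel (\<lambda>x. B *\<^sub>R (indicator {-T..T} x *\<^sub>R k x))"
    using assms(2) unfolding locally_integrable_def set_integrable_def by (intro integrable_scaleR_right) blast
  then show ?thesis
  proof (rule Bochner_Integration.integrable_bound)
    show "AE x in lborel. norm (\<phi> x *\<^sub>R k x) \<le> norm (B *\<^sub>R (indicator {-T..T} x *\<^sub>R k x))"
    proof (rule AE_I2)
      fix x
      show "norm (\<phi> x *\<^sub>R k x) \<le> norm (B *\<^sub>R (indicator {-T..T} x *\<^sub>R k x))"
      proof (cases "x \<in> {-T..T}")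
        case True
        then show ?thesis using B[OF True] by (auto intro: mult_right_mono)
      next
        case False
        then show ?thesis using T(2)[of x] by auto
      qed
    qed
  qed simp
qed

text \<open>Bumps and dominated convergence turn the hypothesis into zero integrals over all open
  intervals. For a truncation of \<open>k\<close> to a compact interval, the Borel sets with zero
  integral then form a Dynkin system containing the rays \<open>{a<..}\<close>, hence every Borel
  set, so each truncation vanishes almost everywhere.\<close>

lemma fundamental_lemma_calculus_of_variations:
  assumes k: "locally_integrable k"
    and 0: "\<And>\<phi>. test_function \<phi> \<Longrightarrow> (LINT x|lborel. \<phi> x *\<^sub>R k x) = 0"
  shows "AE x in lborel. k x = 0"
proof -
  have km[measurable]: "k \<in> borel_measurable borel"
    using locally_integrable_measurable[OF k] by simp
  have ioo: "(LINT x|lborel. indicator {a<..<b} x *\<^sub>R k x) = 0" for a b :: real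
  proof -
    have "(\<lambda>n. LINT x|lborel. bump a b n x *\<^sub>R k x) \<longlonglongrightarrow> (LINT x|lborel. indicator {a<..<b} x *\<^sub>R k x)"
    proof (rule integral_dominated_convergence[where w="\<lambda>x. norm (indicator {a..b} x *\<^sub>R k x)"])
      show "integrable lborel (\<lambda>x. norm (indicator {a..b} x *\<^sub>R k x))"
        using k by (intro integrable_norm) (auto simp: locally_integrable_def set_integrable_def)
      show "(\<lambda>x. bump a b n x *\<^sub>R k x) \<in> borel_measurable lborel" for n
        using integrable_test_function_scaleR[OF test_function_bump k] by auto
      show "AE x in lborel. (\<lambda>n. bump a b n x *\<^sub>R k x) \<longlonglongrightarrow> indicator {a<..<b} x *\<^sub>R k x"
        by (intro AE_I2 tendsto_intros bump_tendsto)
      show "AE x in lborel. norm (bump a b n x *\<^sub>R k x) \<le> norm (indicator {a..b} x *\<^sub>R k x)" for n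
        using bump_bounds[of a b n] by (intro AE_I2) (auto intro!: mult_right_mono)
    qed simp
    then show ?thesis by (auto simp: 0[OF test_function_bump] LIMSEQ_const_iff)
  qed
  have "AE x in lborel. indicator {- real N..real N} x *\<^sub>R k x = 0" for N :: nat
  proof (rule sigma_finite_measure.density_zero[OF sigma_finite_lborel])
    let ?k = "\<lambda>x. indicator {- real N..real N} x *\<^sub>R k x"
    show int: "integrable lborel ?k"
      using k unfolding locally_integrable_def set_integrable_def by blast
    have total: "integral\<^sup>L lborel ?k = 0"
    proof -
      have "integral\<^sup>L lborel ?k = (LINT x|lborel. indicator {- real N<..<real N} x *\<^sub>R k x)"
        using AE_lborel_singleton[of "real N"] AE_lborel_singleton[of "- real N"]
        by (intro integral_cong_AE) (auto simp: indicator_def)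
      then show ?thesis using ioo by simp
    qed
    fix A assume "A \<in> sets (lborel :: real measure)"
    then have A: "A \<in> sigma_sets UNIV (range (\<lambda>a::real. {a<..}))"
      unfolding sets_lborel borel_Ioi by simp
    have "Int_stable (range (\<lambda>a::real. {a<..}))"
      by (auto simp: Int_stable_def lessThan_Int_lessThan)
    moreover have "range (\<lambda>a::real. {a<..}) \<subseteq> Pow UNIV" by simp
    moreover note A
    ultimately have "A \<in> sets borel \<and> set_lebesgue_integral lborel A ?k = 0"
    proof (induction rule: sigma_sets_induct_disjoint)
      case (basic A)
      then obtain a where a: "A = {a<..}" by auto
      have "set_lebesgue_integral lborel A ?k = (LINT x|lborel. indicator {max a (- real N)<..<real N} x *\<^sub>R k x)"
        unfolding set_lebesgue_integral_def a
        using AE_lborel_singleton[of "real N"] AE_lborel_singleton[of "- real N"]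
        by (intro integral_cong_AE) (auto simp: indicator_def)
      then show ?case using ioo a by simp
    next
      case (compl A)
      then have [measurable]: "A \<in> sets borel" by simp
      have "set_lebesgue_integral lborel (UNIV - A) ?k = (LINT x|lborel. ?k x - indicator A x *\<^sub>R ?k x)"
        unfolding set_lebesgue_integral_def by (intro Bochner_Integration.integral_cong) (auto simp: indicator_def)
      also have "\<dots> = integral\<^sup>L lborel ?k - set_lebesgue_integral lborel A ?k"
        unfolding set_lebesgue_integral_def
        by (intro Bochner_Integration.integral_diff int integrable_mult_indicator) auto
      finally show ?case using compl total by auto
    next
      case (union A)
      then have "set_lebesgue_integral lborel (\<Union>i. A i) ?k = (\<Sum>i. set_lebesgue_integral lborel (A i) ?k)"
        unfolding set_integrable_def
        by (intro lebesgue_integral_countable_add)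
          (auto simp: disjoint_family_on_def set_integrable_def simp del: scaleR_scaleR
            intro!: integrable_mult_indicator int)
      with union show ?case by auto
    qed (auto simp: set_lebesgue_integral_def)
    then show "set_lebesgue_integral lborel A ?k = 0" by simp
  qed
  then have "AE x in lborel. \<forall>N::nat. indicator {- real N..real N} x *\<^sub>R k x = 0"
    by (simp only: AE_all_countable) blast
  then show ?thesis
  proof eventually_elim
    case (elim x)
    obtain N where "\<bar>x\<bar> \<le> real N" using real_arch_simple by blast
    with elim[rule_format, of N] show ?case by (auto simp: indicator_def abs_le_iff split: if_splits)
  qed
qed

section \<open>Uniqueness of weak derivatives and agreement with classical ones\<close>

lemma has_weak_deriv_unique:
  assumes "f has_weak_deriv g" "f has_weak_deriv h"
  shows "ae_eq g h"
proof -
  have gh: "locally_integrable g" "locally_integrable h"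
    using assms by (auto simp: has_weak_deriv_def)
  have "AE x in lborel. g x - h x = 0"
  proof (rule fundamental_lemma_calculus_of_variations)
    show "locally_integrable (\<lambda>x. g x - h x)"
      using gh by (auto simp: locally_integrable_def)
    fix \<phi> :: "real \<Rightarrow> real" assume \<phi>: "test_function \<phi>"
    have "(LINT x|lborel. \<phi> x *\<^sub>R g x) = (LINT x|lborel. \<phi> x *\<^sub>R h x)"
    proof -
      have "(LINT x|lborel. deriv \<phi> x *\<^sub>R f x) = - (LINT x|lborel. \<phi> x *\<^sub>R g x)"
        "(LINT x|lborel. deriv \<phi> x *\<^sub>R f x) = - (LINT x|lborel. \<phi> x *\<^sub>R h x)"
        using assms \<phi> unfolding has_weak_deriv_def by blast+
      then show ?thesis by simp
    qed
    then show "(LINT x|lborel. \<phi> x *\<^sub>R (g x - h x)) = 0"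
      by (simp add: scaleR_diff_right
          Bochner_Integration.integral_diff[OF integrable_test_function_scaleR[OF \<phi> gh(1)]
            integrable_test_function_scaleR[OF \<phi> gh(2)]])
  qed
  then show ?thesis by (simp add: ae_eq_def)
qed

lemma continuous_imp_locally_integrable:
  "continuous_on UNIV f \<Longrightarrow> locally_integrable f"
  unfolding locally_integrable_def
  by (intro allI borel_integrable_atLeastAtMost') (auto intro: continuous_on_subset)

lemma has_vector_derivative_imp_continuous_on:
  assumes "\<And>x. (f has_vector_derivative f' x) (at x)"
  shows "continuous_on S f"
  by (intro continuous_at_imp_continuous_on ballI has_vector_derivative_continuous[OF assms])

lemma has_weak_deriv_C1:
  fixes f :: "real \<Rightarrow> 'a::euclidean_space"
  assumes f: "\<And>x. (f has_vector_derivative f' x) (at x)" and f': "continuous_on UNIV f'"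
  shows "f has_weak_deriv f'"
proof -
  have cf: "continuous_on UNIV f"
    by (rule has_vector_derivative_imp_continuous_on[OF f])
  have "(LINT x|lborel. deriv \<phi> x *\<^sub>R f x) = - (LINT x|lborel. \<phi> x *\<^sub>R f' x)" if \<phi>: "test_function \<phi>" for \<phi>
  proof -
    from test_function_support[OF \<phi>] obtain T where T: "T > 0" "\<And>x. \<bar>x\<bar> \<ge> T \<Longrightarrow> \<phi> x = 0" "\<And>x. \<bar>x\<bar> \<ge> T \<Longrightarrow> deriv \<phi> x = 0" by metis
    note d = test_function_deriv[OF \<phi>]
    have eq: "(\<lambda>x. deriv \<phi> x *\<^sub>R f x) = (\<lambda>x. indicator {-T..T} x *\<^sub>R (deriv \<phi> x *\<^sub>R f x))"
      "(\<lambda>x. \<phi> x *\<^sub>R f' x) = (\<lambda>x. indicator {-T..T} x *\<^sub>R (\<phi> x *\<^sub>R f' x))"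
      using T by (auto simp: fun_eq_iff indicator_def not_le intro!: T(2,3))
    have c: "continuous_on {-T..T} (\<lambda>x. deriv \<phi> x *\<^sub>R f x)" "continuous_on {-T..T} (\<lambda>x. \<phi> x *\<^sub>R f' x)"
      by (intro continuous_intros continuous_on_subset[OF d(2)] continuous_on_subset[OF d(3)]
          continuous_on_subset[OF cf] continuous_on_subset[OF f'] subset_UNIV)+
    \<comment> \<open>Integration by parts on an interval carrying \<open>\<phi>\<close>; the
      boundary terms vanish since \<open>\<phi>\<close> is 0 at \<open>T\<close> and
      \<open>- T\<close>.\<close>
    have "(LINT x|lborel. indicator {-T..T} x *\<^sub>R (\<phi> x *\<^sub>R f' x + deriv \<phi> x *\<^sub>R f x)) = \<phi> T *\<^sub>R f T - \<phi> (-T) *\<^sub>R f (-T)"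
    proof (rule integral_FTC_atLeastAtMost)
      show "((\<lambda>x. \<phi> x *\<^sub>R f x) has_vector_derivative \<phi> x *\<^sub>R f' x + deriv \<phi> x *\<^sub>R f x) (at x within {-T..T})" for x
        using has_vector_derivative_scaleR[OF d(1) f] by (rule has_vector_derivative_at_within)
      show "continuous_on {-T..T} (\<lambda>x. \<phi> x *\<^sub>R f' x + deriv \<phi> x *\<^sub>R f x)"
        by (intro continuous_on_add c)
    qed (use T in auto)
    also have "\<dots> = 0" using T by simp
    finally have "(LINT x|lborel. indicator {-T..T} x *\<^sub>R (\<phi> x *\<^sub>R f' x)) + (LINT x|lborel. indicator {-T..T} x *\<^sub>R (deriv \<phi> x *\<^sub>R f x)) = 0"
      using c[THEN borel_integrable_atLeastAtMost'] by (simp add: scaleR_add_right set_integrable_def)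
    then show ?thesis unfolding eq[symmetric] by (simp add: eq_neg_iff_add_eq_0 add.commute)
  qed
  then show ?thesis
    using cf f' continuous_imp_locally_integrable unfolding has_weak_deriv_def by blast
qed

lemma weak_deriv_C1:
  fixes f :: "real \<Rightarrow> 'a::euclidean_space"
  assumes "\<And>x. (f has_vector_derivative f' x) (at x)" "continuous_on UNIV f'"
  shows "ae_eq (weak_deriv f) f'"
proof -
  have *: "f has_weak_deriv f'" using has_weak_deriv_C1 assms by blast
  then have "f has_weak_deriv (weak_deriv f)" unfolding weak_deriv_def by (rule someI[of "(has_weak_deriv) f"])
  with * show ?thesis using has_weak_deriv_unique by blast
qed

lemma locally_integrable_ae_eq:
  assumes "locally_integrable f" "ae_eq f g" "g \<in> borel_measurable lborel"
  shows "locally_integrable g"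
  unfolding locally_integrable_def
proof (intro allI)
  fix a b :: real
  have [measurable]: "f \<in> borel_measurable borel" "g \<in> borel_measurable borel"
    using locally_integrable_measurable[OF assms(1)] assms(3) by auto
  show "set_integrable lborel {a..b} g"
    using assms(1,2) unfolding locally_integrable_def set_integrable_def ae_eq_def
    by (elim allE[of _ a] allE[of _ b] integrable_cong_AE[THEN iffD1, rotated -1]) auto
qed

text \<open>Serves iterated weak derivatives: \<open>weak_deriv (weak_deriv f)\<close>
  differentiates a representative picked by choice, which is known to equal the classical derivative
  only almost everywhere.\<close>

lemma has_weak_deriv_ae_eq:
  assumes "f has_weak_deriv h" "ae_eq f g" "g \<in> borel_measurable lborel"
  shows "g has_weak_deriv h"
  unfolding has_weak_deriv_def
proof (intro conjI allI impI)
  have f: "locally_integrable f" using assms by (simp add: has_weak_deriv_def)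
  then show "locally_integrable g" using assms locally_integrable_ae_eq by blast
  show "locally_integrable h" using assms by (simp add: has_weak_deriv_def)
  fix \<phi> :: "real \<Rightarrow> real" assume \<phi>: "test_function \<phi>"
  have [measurable]: "f \<in> borel_measurable borel" "g \<in> borel_measurable borel"
    "deriv \<phi> \<in> borel_measurable borel"
    using locally_integrable_measurable[OF f] assms(3) test_function_deriv[OF \<phi>]
    by (auto intro: borel_measurable_continuous_onI)
  have "(LINT x|lborel. deriv \<phi> x *\<^sub>R g x) = (LINT x|lborel. deriv \<phi> x *\<^sub>R f x)"
    using assms(2) unfolding ae_eq_def by (intro integral_cong_AE) auto
  then show "(LINT x|lborel. deriv \<phi> x *\<^sub>R g x) = - (LINT x|lborel. \<phi> x *\<^sub>R h x)"
    using assms(1) \<phi> by (simp add: has_weak_deriv_def)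
qed

lemma weak_deriv_weak_deriv_C2:
  fixes f :: "real \<Rightarrow> 'a::euclidean_space"
  assumes f: "\<And>x. (f has_vector_derivative f' x) (at x)"
    and f': "\<And>x. (f' has_vector_derivative f'' x) (at x)" and f'': "continuous_on UNIV f''"
  shows "ae_eq (weak_deriv (weak_deriv f)) f''"
proof -
  have c: "continuous_on UNIV f'"
    by (rule has_vector_derivative_imp_continuous_on[OF f'])
  have 1: "f has_weak_deriv f'" using has_weak_deriv_C1 f c by blast
  then have "f has_weak_deriv (weak_deriv f)" unfolding weak_deriv_def by (rule someI[of "(has_weak_deriv) f"])
  then have m: "weak_deriv f \<in> borel_measurable lborel"
    by (intro locally_integrable_measurable) (auto simp: has_weak_deriv_def)
  have "ae_eq f' (weak_deriv f)" using weak_deriv_C1[OF f c] by (auto simp: ae_eq_def)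
  then have *: "weak_deriv f has_weak_deriv f''"
    using has_weak_deriv_ae_eq has_weak_deriv_C1[OF f' f''] m by blast
  then have "weak_deriv f has_weak_deriv (weak_deriv (weak_deriv f))"
    unfolding weak_deriv_def[of "weak_deriv f"] by (rule someI[of "(has_weak_deriv) (weak_deriv f)"])
  with * show ?thesis using has_weak_deriv_unique by blast
qed

subsection \<open>Real analysis\<close>

text \<open>The set where \<open>f\<close> and \<open>g\<close> differ is open, and a nonempty open
  set is not null.\<close>

lemma ae_eq_continuous:
  assumes "ae_eq f g" "continuous_on UNIV f" "continuous_on UNIV g"
  shows "f = g"
proof (rule ccontr)
  assume "f \<noteq> g"
  let ?S = "{x. f x \<noteq> g x}"
  have op: "open ?S" using assms(2,3) by (intro open_Collect_neq)
  then have "?S \<in> sets borel" by auto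
  with assms(1) have "?S \<in> null_sets lborel"
    unfolding ae_eq_def by (subst (asm) AE_iff_null) auto
  then have "negligible ?S"
    unfolding negligible_iff_null_sets by (rule null_sets_completionI)
  moreover have "?S \<noteq> {}" using \<open>f \<noteq> g\<close> by auto
  ultimately show False using open_not_negligible[OF op] by blast
qed

section \<open>Mean value estimates\<close>

lemma norm_diff_le_vector_derivative:
  fixes f :: "real \<Rightarrow> 'a::real_normed_vector"
  assumes "\<And>x. (f has_vector_derivative f' x) (at x)" "\<And>x. x \<in> S \<Longrightarrow> norm (f' x) \<le> N"
    and "convex S" "x \<in> S" "y \<in> S"
  shows "norm (f y - f x) \<le> N * \<bar>y - x\<bar>"
proof -
  have "norm (f y - f x) \<le> N * norm (y - x)"
  proof (rule differentiable_bound[OF assms(3) _ _ assms(5,4)])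
    fix z assume z: "z \<in> S"
    show "(f has_derivative (\<lambda>h. h *\<^sub>R f' z)) (at z within S)"
      using assms(1) has_vector_derivative_at_within has_vector_derivative_def by blast
    show "onorm (\<lambda>h. h *\<^sub>R f' z) \<le> N"
      using assms(2)[OF z] by (intro onorm_le) (auto simp: mult.commute[of N] intro: mult_left_mono)
  qed
  then show ?thesis by simp
qed

lemma first_order_remainder:
  fixes f :: "real \<Rightarrow> 'a::real_normed_vector"
  assumes f: "\<And>x. (f has_vector_derivative f' x) (at x)"
    and S: "convex S" "x \<in> S" "y \<in> S" and B: "\<And>z. z \<in> S \<Longrightarrow> norm (f' z - f' x) \<le> B"
  shows "norm (f y - f x - (y - x) *\<^sub>R f' x) \<le> \<bar>y - x\<bar> * B"
  using vector_differentiable_bound_linearization[where S=S and a=x and b=y and f=f and f'=f' and ?x0.0=x and B=B]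
    f S B has_vector_derivative_at_within closed_segment_subset[OF S(2,3,1)] by fastforce

text \<open>Taylor expansion over a unit step: \<open>f (x + 1) - f x\<close> differs from
  \<open>f' x\<close> by at most \<open>N\<close>. Only bounds on the interval from \<open>x\<close>
  to \<open>x + 1\<close> enter, so decay of \<open>f\<close> and \<open>f''\<close> passes to
  \<open>f'\<close>.\<close>

lemma norm_derivative_le:
  fixes f :: "real \<Rightarrow> 'a::real_normed_vector"
  assumes f: "\<And>x. (f has_vector_derivative f' x) (at x)"
    and f': "\<And>x. (f' has_vector_derivative f'' x) (at x)"
    and M: "\<And>y. x \<le> y \<Longrightarrow> y \<le> x + 1 \<Longrightarrow> norm (f y) \<le> M"
    and N: "\<And>y. x \<le> y \<Longrightarrow> y \<le> x + 1 \<Longrightarrow> norm (f'' y) \<le> N"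
  shows "norm (f' x) \<le> 2 * M + N"
proof -
  have "N \<ge> 0" using N[of x] norm_ge_zero[of "f'' x"] by linarith
  have "norm (f' z - f' x) \<le> N" if "z \<in> {x..x+1}" for z
  proof -
    have "norm (f' z - f' x) \<le> N * \<bar>z - x\<bar>"
      by (rule norm_diff_le_vector_derivative[where S="{x..x+1}", OF f']) (use N that in auto)
    also have "\<dots> \<le> N * 1" using that \<open>N \<ge> 0\<close> by (intro mult_left_mono) auto
    finally show ?thesis by simp
  qed
  then have "norm (f (x + 1) - f x - (x + 1 - x) *\<^sub>R f' x) \<le> \<bar>x + 1 - x\<bar> * N"
    by (intro first_order_remainder[where S="{x..x+1}"] f) auto
  moreover have "norm (f (x + 1)) \<le> M" "norm (f x) \<le> M" using M by auto
  moreover have "norm (f' x) \<le> norm (f (x + 1) - f x - f' x) + (norm (f (x+1)) + norm (f x))"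
    by norm
  ultimately show ?thesis by simp
qed

section \<open>Exponential decay of bounded subsolutions\<close>

lemma bounded_subsolution_decay_right:
  fixes q :: "real \<Rightarrow> real"
  assumes \<kappa>: "\<kappa> > 0"
    and q: "\<And>x. (q has_real_derivative q' x) (at x)"
    and q': "\<And>x. (q' has_real_derivative q'' x) (at x)"
    and ge: "\<And>x. x \<ge> R \<Longrightarrow> q'' x \<ge> \<kappa>\<^sup>2 * q x"
    and bnd: "\<And>x. 0 \<le> q x" "\<And>x. q x \<le> M"
    and x: "x \<ge> R"
  shows "q x \<le> q R * exp (\<kappa> * (R - x))"
proof -
  \<comment> \<open>\<open>p exp(-\<kappa> x)\<close> is nondecreasing on \<open>[R, \<infinity>)\<close>, so \<open>p > 0\<close> somewhere would force \<open>q\<close> to be unbounded;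
    and \<open>p \<le> 0\<close> says that \<open>q exp(\<kappa> x)\<close> is nonincreasing.\<close>
  define p where "p x = q' x + \<kappa> * q x" for x
  have p: "p a \<le> 0" if a: "a \<ge> R" for a
  proof (rule ccontr)
    assume "\<not> p a \<le> 0"
    then have pa: "p a > 0" by simp
    \<comment> \<open>Since q'' - \<kappa>^2 q = p' - \<kappa> p, the differential inequality reads
      p' \<ge> \<kappa> p.\<close>
    have growth: "p a * exp (\<kappa> * (x - a)) \<le> p x" if "x \<ge> a" for x
    proof -
      have "p a * exp (- \<kappa> * a) \<le> p x * exp (- \<kappa> * x)"
      proof (rule DERIV_nonneg_imp_nondecreasing[OF that])
        fix y assume y: "a \<le> y"
        have "((\<lambda>x. p x * exp (- \<kappa> * x)) has_real_derivative (q'' y - \<kappa>\<^sup>2 * q y) * exp (- \<kappa> * y)) (at y)"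
          unfolding p_def
          by (auto intro!: derivative_eq_intros q q' simp: algebra_simps power2_eq_square)
        moreover have "(q'' y - \<kappa>\<^sup>2 * q y) * exp (- \<kappa> * y) \<ge> 0" using ge[of y] y a by simp
        ultimately show "\<exists>d. ((\<lambda>x. p x * exp (- \<kappa> * x)) has_real_derivative d) (at y) \<and> d \<ge> 0" by blast
      qed
      then have "p a * exp (- \<kappa> * a) * exp (\<kappa> * x) \<le> p x * exp (- \<kappa> * x) * exp (\<kappa> * x)"
        by (intro mult_right_mono) auto
      then show ?thesis by (simp add: mult.assoc exp_add[symmetric] algebra_simps)
    qed
    \<comment> \<open>From \<open>b\<close> on, \<open>p a * (x - a)\<close> is at least
      \<open>M\<close>. As exp(y) \<ge> 1 + y, the growth of \<open>p\<close> then compensates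
      \<open>\<kappa> * q x\<close> and leaves a slope of at least \<open>p a\<close> for
      \<open>q\<close>.\<close>
    define b where "b = a + M / p a"
    have M: "M \<ge> 0" using bnd order_trans by blast
    then have ba: "b \<ge> a" using pa by (simp add: b_def)
    have q'_ge: "q' x \<ge> p a" if "x \<ge> b" for x
    proof -
      have xa: "x \<ge> a" using that ba by simp
      have "M \<le> p a * (x - a)" using that pa by (simp add: b_def field_simps)
      then have "\<kappa> * M \<le> \<kappa> * (p a * (x - a))" using \<kappa> by simp
      moreover have "p a * (1 + \<kappa> * (x - a)) \<le> p a * exp (\<kappa> * (x - a))"
        using pa exp_ge_add_one_self[of "\<kappa> * (x - a)"] by simp
      moreover have "\<kappa> * q x \<le> \<kappa> * M" using bnd \<kappa> by simp
      ultimately show ?thesis using growth[OF xa] unfolding p_def[of x] by (simp add: algebra_simps)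
    qed
    \<comment> \<open>With slope at least \<open>p a\<close> from \<open>b\<close> on, this length
      lifts \<open>q\<close> by at least \<open>M + 1\<close>, beyond its upper bound
      \<open>M\<close>.\<close>
    define c where "c = b + (M + 1) / p a"
    have cb: "b \<le> c" using pa M by (simp add: c_def)
    have "q b - p a * b \<le> q c - p a * c"
    proof (rule DERIV_nonneg_imp_nondecreasing[OF cb])
      fix y assume y: "b \<le> y"
      show "\<exists>d. ((\<lambda>x. q x - p a * x) has_real_derivative d) (at y) \<and> d \<ge> 0"
        using q'_ge[OF y] by (intro exI[of _ "q' y - p a"]) (auto intro!: derivative_eq_intros q)
    qed
    moreover have "p a * (c - b) = M + 1" using pa by (simp add: c_def)
    ultimately have "q c \<ge> M + 1" using bnd(1)[of b] by (simp add: algebra_simps)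
    then show False using bnd(2)[of c] by simp
  qed
  have "q x * exp (\<kappa> * x) \<le> q R * exp (\<kappa> * R)"
  proof (rule DERIV_nonpos_imp_nonincreasing[OF x])
    fix y assume y: "R \<le> y"
    have "((\<lambda>x. q x * exp (\<kappa> * x)) has_real_derivative p y * exp (\<kappa> * y)) (at y)"
      unfolding p_def by (auto intro!: derivative_eq_intros q simp: algebra_simps)
    moreover have "p y * exp (\<kappa> * y) \<le> 0" using p[OF y] by (simp add: mult_nonpos_nonneg)
    ultimately show "\<exists>d. ((\<lambda>x. q x * exp (\<kappa> * x)) has_real_derivative d) (at y) \<and> d \<le> 0" by blast
  qed
  then have "q x * exp (\<kappa> * x) * exp (- \<kappa> * x) \<le> q R * exp (\<kappa> * R) * exp (- \<kappa> * x)"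
    by (intro mult_right_mono) auto
  then show ?thesis by (simp add: mult.assoc exp_add[symmetric] algebra_simps)
qed

text \<open>Reflection preserves second derivatives, so the left half-line reduces to the right one;
  the larger of the two boundary values serves both.\<close>

lemma bounded_subsolution_decay:
  fixes q :: "real \<Rightarrow> real"
  assumes \<kappa>: "\<kappa> > 0"
    and q: "\<And>x. (q has_real_derivative q' x) (at x)"
    and q': "\<And>x. (q' has_real_derivative q'' x) (at x)"
    and ge: "\<And>x. \<bar>x\<bar> \<ge> R \<Longrightarrow> q'' x \<ge> \<kappa>\<^sup>2 * q x"
    and bnd: "\<And>x. 0 \<le> q x" "\<And>x. q x \<le> M"
    and R: "R \<ge> 0" and x: "\<bar>x\<bar> \<ge> R"
  shows "q x \<le> max (q R) (q (- R)) * exp (\<kappa> * (R - \<bar>x\<bar>))"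
proof (cases "x \<ge> 0")
  case True
  then have "q x \<le> q R * exp (\<kappa> * (R - x))"
    using x R by (intro bounded_subsolution_decay_right[OF \<kappa> q q' ge bnd]) auto
  also have "\<dots> \<le> max (q R) (q (- R)) * exp (\<kappa> * (R - x))" by (intro mult_right_mono) auto
  finally show ?thesis using True by simp
next
  case False
  have mirror: "(uminus has_real_derivative - 1) (at x)" for x :: real
    by (auto intro!: derivative_eq_intros)
  have "q (- (- x)) \<le> q (- R) * exp (\<kappa> * (R - (- x)))"
  proof (rule bounded_subsolution_decay_right[OF \<kappa>, where q="\<lambda>x. q (- x)"])
    show "((\<lambda>x. q (- x)) has_real_derivative - q' (- x)) (at x)" for x
      using DERIV_chain2[OF q mirror, of x] by simp
    show "((\<lambda>x. - q' (- x)) has_real_derivative q'' (- x)) (at x)" for x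
      using DERIV_minus[OF DERIV_chain2[OF q' mirror, of x]] by simp
  qed (use ge bnd x False R in auto)
  also have "\<dots> \<le> max (q R) (q (- R)) * exp (\<kappa> * (R - (- x)))" by (intro mult_right_mono) auto
  finally show ?thesis using False by simp
qed

text \<open>By Tychonoff's theorem; a filter replaces the diagonal subsequence of Arzela-Ascoli.\<close>

lemma bounded_sequence_cluster_filter:
  fixes f :: "nat \<Rightarrow> 'i \<Rightarrow> 'b::euclidean_space"
  assumes "\<And>n i. norm (f n i) \<le> B"
  obtains F g where "F \<noteq> bot" "F \<le> sequentially" "\<And>i. ((\<lambda>n. f n i) \<longlongrightarrow> g i) F"
proof -
  let ?K = "PiE UNIV (\<lambda>_::'i. cball (0::'b) B)"
  have "compactin (product_topology (\<lambda>_. euclidean) UNIV) ?K"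
    by (subst compactin_PiE) auto
  then have "compact ?K"
    by (simp add: euclidean_product_topology)
  moreover have "filtermap f sequentially \<noteq> bot"
    by (simp add: filtermap_bot_iff)
  moreover have "eventually (\<lambda>h. h \<in> ?K) (filtermap f sequentially)"
    using assms by (simp add: eventually_filtermap PiE_iff)
  ultimately obtain g where g: "inf (nhds g) (filtermap f sequentially) \<noteq> bot"
    unfolding compact_filter by blast
  \<comment> \<open>\<open>F\<close> is generated by the sets of late indices \<open>n\<close> for
    which \<open>f n\<close> is close to the cluster point \<open>g\<close>. That these sets are
    nonempty is exactly the cluster property.\<close>
  define F where "F = inf sequentially (filtercomap f (nhds g))"
  have "F \<noteq> bot"
  proof
    assume "F = bot"
    then have "eventually (\<lambda>_. False) F" by simp
    then obtain P Q where P: "eventually P sequentially" and Q: "eventually Q (filtercomap f (nhds g))"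
      and PQ: "\<And>n. P n \<Longrightarrow> Q n \<Longrightarrow> False" unfolding F_def eventually_inf by blast
    from Q obtain S where S: "eventually S (nhds g)" "\<And>n. S (f n) \<Longrightarrow> Q n"
      unfolding eventually_filtercomap by blast
    have "eventually (\<lambda>h. \<not> S h) (filtermap f sequentially)"
      unfolding eventually_filtermap using P by eventually_elim (use PQ S in blast)
    with S(1) have "eventually (\<lambda>_. False) (inf (nhds g) (filtermap f sequentially))"
      unfolding eventually_inf by blast
    with g show False by (simp add: trivial_limit_def)
  qed
  moreover have "F \<le> sequentially" by (simp add: F_def)
  moreover have "((\<lambda>n. f n i) \<longlongrightarrow> g i) F" for i
  proof -
    have f: "filterlim f (nhds g) F"
      unfolding F_def filterlim_iff_le_filtercomap by simp
    show ?thesis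
    proof (rule topological_tendstoI)
      fix S assume "open S" "g i \<in> S"
      then have "eventually (\<lambda>h. h \<in> (\<lambda>h. h i) -` S) (nhds g)"
        by (intro eventually_nhds_in_open open_vimage continuous_on_product_coordinates) auto
      then show "eventually (\<lambda>n. f n i \<in> S) F"
        using f by (auto simp: filterlim_iff)
    qed
  qed
  ultimately show ?thesis using that by blast
qed

section \<open>Exponential weights, and uniform bounds from the \<open>L2\<close> norm\<close>

lemma integrable_exp_abs:
  fixes c :: real
  assumes c: "c > 0"
  shows "integrable lborel (\<lambda>x. exp (- c * \<bar>x\<bar>))"
proof -
  let ?f = "\<lambda>x. ennreal (exp (- c * x)) * indicator {0..} x"
  have half: "(\<integral>\<^sup>+x. ?f x \<partial>lborel) = 0 - (- exp (- c * 0) / c)"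
  proof (rule nn_integral_FTC_atLeast)
    show "((\<lambda>x. - exp (- c * x) / c) has_real_derivative exp (- c * x)) (at x)" for x
      using c by (auto intro!: derivative_eq_intros)
    have "((\<lambda>x. - exp (- (c * x)) / c) \<longlongrightarrow> - 0 / c) at_top"
      using c by (intro tendsto_intros filterlim_compose[OF exp_at_bot]
        filterlim_compose[OF filterlim_uminus_at_bot_at_top] filterlim_tendsto_pos_mult_at_top[OF tendsto_const]
        filterlim_ident) auto
    then show "((\<lambda>x. - exp (- c * x) / c) \<longlongrightarrow> 0) at_top" by simp
  qed auto
  have "(\<integral>\<^sup>+x. ?f (0 + (-1) * x) \<partial>lborel) = (\<integral>\<^sup>+x. ?f x \<partial>lborel)"
    by (subst nn_integral_real_affine[where c="-1" and t=0 and f="?f"]) auto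
  then have half': "(\<integral>\<^sup>+x. ?f (- x) \<partial>lborel) = (\<integral>\<^sup>+x. ?f x \<partial>lborel)" by simp
  have "(\<integral>\<^sup>+x. ennreal (norm (exp (- c * \<bar>x\<bar>))) \<partial>lborel) \<le> (\<integral>\<^sup>+x. ?f x + ?f (- x) \<partial>lborel)"
    by (intro nn_integral_mono) (auto simp: indicator_def abs_if)
  also have "\<dots> = (\<integral>\<^sup>+x. ?f x \<partial>lborel) + (\<integral>\<^sup>+x. ?f (- x) \<partial>lborel)"
    by (intro nn_integral_add) auto
  also have "\<dots> < \<infinity>" unfolding half' half by (simp add: less_top[symmetric])
  finally show ?thesis by (intro integrableI_bounded) auto
qed

lemma L2_exp_decay:
  fixes f :: "real \<Rightarrow> 'a::euclidean_space"
  assumes c: "c > 0" and f: "continuous_on UNIV f" and le: "\<And>x. norm (f x) \<le> C * exp (- c * \<bar>x\<bar>)"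
  shows "f \<in> L2"
proof -
  have [measurable]: "f \<in> borel_measurable borel" using f by (rule borel_measurable_continuous_onI)
  have "integrable lborel (\<lambda>x. C\<^sup>2 * exp (- (2 * c) * \<bar>x\<bar>))"
    using integrable_exp_abs[of "2 * c"] c by simp
  then have "integrable lborel (\<lambda>x. (norm (f x))\<^sup>2)"
  proof (rule Bochner_Integration.integrable_bound)
    show "AE x in lborel. norm ((norm (f x))\<^sup>2) \<le> norm (C\<^sup>2 * exp (- (2 * c) * \<bar>x\<bar>))"
    proof (rule AE_I2)
      fix x
      have "(norm (f x))\<^sup>2 \<le> (C * exp (- c * \<bar>x\<bar>))\<^sup>2" using le by (intro power_mono) auto
      then show "norm ((norm (f x))\<^sup>2) \<le> norm (C\<^sup>2 * exp (- (2 * c) * \<bar>x\<bar>))"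
        by (simp add: power_mult_distrib exp_double[symmetric] mult.assoc)
    qed
  qed simp
  then show ?thesis by (simp add: L2_def)
qed

text \<open>If |D(x)| = d, the Lipschitz bound keeps |D| above d/2 on an interval of length d/(2K),
  which alone contributes d^3/(8K) to the integral of |D|^2.\<close>

lemma lipschitz_norm_L2_bound:
  fixes D :: "real \<Rightarrow> 'a::euclidean_space"
  assumes K: "K > 0" and lip: "\<And>x y. norm (D y - D x) \<le> K * \<bar>y - x\<bar>"
    and small: "norm_L2 D < ennreal \<eta>" and \<eta>: "\<eta> > 0"
  shows "norm (D x) ^ 3 \<le> 8 * K * \<eta>\<^sup>2"
proof -
  define d where "d = norm (D x)"
  let ?I = "\<integral>\<^sup>+ x. ennreal ((norm (D x))\<^sup>2) \<partial>lborel"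
  have fin: "?I \<noteq> \<infinity>" using small by (auto simp: norm_L2_def Let_def)
  then have "ennreal (sqrt (enn2real ?I)) < ennreal \<eta>" using small by (simp add: norm_L2_def Let_def)
  then have "sqrt (enn2real ?I) < \<eta>" by (simp add: ennreal_less_iff)
  then have "enn2real ?I < \<eta>\<^sup>2" using real_sqrt_less_iff[of "enn2real ?I" "\<eta>\<^sup>2"] \<eta> by simp
  then have I: "?I \<le> ennreal (\<eta>\<^sup>2)" using fin by (metis ennreal_enn2real_if ennreal_leI infinity_ennreal_def less_imp_le)
  have d0: "d \<ge> 0" by (simp add: d_def)
  have ge: "d / 2 \<le> norm (D y)" if "y \<in> {x..x + d / (2 * K)}" for y
  proof -
    have "norm (D y - D x) \<le> K * \<bar>y - x\<bar>" by (rule lip)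
    also have "\<dots> \<le> K * (d / (2 * K))" using that K by (intro mult_left_mono) auto
    also have "\<dots> = d / 2" using K by simp
    finally show ?thesis using norm_triangle_ineq2[of "D x" "D y"] by (simp add: d_def norm_minus_commute)
  qed
  have "ennreal ((d / 2)\<^sup>2 * (d / (2 * K))) = (\<integral>\<^sup>+ y. ennreal ((d / 2)\<^sup>2) * indicator {x..x + d / (2 * K)} y \<partial>lborel)"
    using d0 K by (subst nn_integral_cmult_indicator) (auto simp: ennreal_mult[symmetric])
  also have "\<dots> \<le> ?I"
    using ge d0 by (intro nn_integral_mono) (auto simp: indicator_def intro!: ennreal_leI power_mono)
  finally have "ennreal ((d / 2)\<^sup>2 * (d / (2 * K))) \<le> ennreal (\<eta>\<^sup>2)" using I by order
  then have "(d / 2)\<^sup>2 * (d / (2 * K)) \<le> \<eta>\<^sup>2" by (simp add: ennreal_le_iff)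
  then show ?thesis using K by (simp add: d_def[symmetric] field_simps power2_eq_square power3_eq_cube)
qed

text \<open>At a maximum \<open>q' x = 0\<close>, and \<open>q'' x > 0\<close> makes
  \<open>q'\<close> positive just to the right, so \<open>q\<close> would increase there.\<close>

lemma no_interior_max:
  fixes q :: "real \<Rightarrow> real"
  assumes q: "\<And>x. (q has_real_derivative q' x) (at x)"
    and q': "\<And>x. (q' has_real_derivative q'' x) (at x)" and pos: "q'' x > 0"
  shows "\<exists>y. q y > q x"
proof (rule ccontr)
  assume "\<nexists>y. q y > q x"
  then have max: "q y \<le> q x" for y by (meson not_le)
  then have "q' x = 0" using DERIV_local_max[OF q[of x], of 1] by simp
  from DERIV_pos_inc_right[OF q' pos] obtain d where d: "d > 0" "\<And>h. 0 < h \<Longrightarrow> h < d \<Longrightarrow> q' x < q' (x + h)" by blast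
  have "q x < q (x + d / 2)"
  proof (rule DERIV_pos_imp_increasing_open[where f=q])
    show "x < x + d / 2" using d by simp
    show "\<exists>y. (q has_real_derivative y) (at z) \<and> 0 < y" if "x < z" "z < x + d / 2" for z
      using q[of z] d(2)[of "z - x"] that \<open>q' x = 0\<close> by (intro exI[of _ "q' z"]) auto
    show "continuous_on {x..x + d / 2} q" using q by (meson DERIV_isCont continuous_at_imp_continuous_on)
  qed
  then show False using max[of "x + d / 2"] by simp
qed

subsection \<open>The nonlinearity and its linearisation\<close>

definition nonlin :: "real \<Rightarrow> real \<times> real \<Rightarrow> real \<times> real" where
  "nonlin \<gamma> u = (((fst u)\<^sup>2 + \<gamma> * (snd u)\<^sup>2 - 1) * fst u, (\<gamma> * (fst u)\<^sup>2 + (snd u)\<^sup>2 - 1) * snd u)"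

text \<open>The Jacobian of \<open>nonlin \<gamma>\<close> at \<open>u\<close> applied to
  \<open>w\<close>; along \<open>U\<close> it is the potential term of
  \<open>L_plus \<gamma> U\<close>.\<close>

definition lin :: "real \<Rightarrow> real \<times> real \<Rightarrow> real \<times> real \<Rightarrow> real \<times> real" where
  "lin \<gamma> u w =
     ((3 * (fst u)\<^sup>2 + \<gamma> * (snd u)\<^sup>2 - 1) * fst w + 2 * \<gamma> * fst u * snd u * snd w,
      2 * \<gamma> * fst u * snd u * fst w + (\<gamma> * (fst u)\<^sup>2 + 3 * (snd u)\<^sup>2 - 1) * snd w)"

lemma is_solution_iff:
  "is_solution \<gamma> V \<longleftrightarrow> (\<exists>V'. \<forall>x. (V has_vector_derivative V' x) (at x) \<and>
     (V' has_vector_derivative nonlin \<gamma> (V x)) (at x))"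
proof -
  have *: "(- fst a + ((fst u)\<^sup>2 + \<gamma> * (snd u)\<^sup>2 - 1) * fst u = 0 \<and>
     - snd a + (\<gamma> * (fst u)\<^sup>2 + (snd u)\<^sup>2 - 1) * snd u = 0) \<longleftrightarrow> a = nonlin \<gamma> u" for a u :: "real \<times> real"
    by (auto simp: nonlin_def prod_eq_iff)
  show ?thesis unfolding is_solution_def *
  proof (rule iffI; elim exE)
    fix V' V'' assume "\<forall>x. (V has_vector_derivative V' x) (at x) \<and> (V' has_vector_derivative V'' x) (at x) \<and>
      V'' x = nonlin \<gamma> (V x)"
    then show "\<exists>V'. \<forall>x. (V has_vector_derivative V' x) (at x) \<and> (V' has_vector_derivative nonlin \<gamma> (V x)) (at x)"
      by (intro exI[of _ V']) metis
  next
    fix V' assume "\<forall>x. (V has_vector_derivative V' x) (at x) \<and> (V' has_vector_derivative nonlin \<gamma> (V x)) (at x)"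
    then show "\<exists>V' V''. \<forall>x. (V has_vector_derivative V' x) (at x) \<and> (V' has_vector_derivative V'' x) (at x) \<and>
      V'' x = nonlin \<gamma> (V x)"
      by (intro exI[of _ V'] exI[of _ "\<lambda>x. nonlin \<gamma> (V x)"]) simp
  qed
qed

lemma L_plus_eq: "L_plus \<gamma> U W x = lin \<gamma> (U x) (W x) - weak_deriv (weak_deriv W) x"
  by (simp add: L_plus_def lin_def Let_def prod_eq_iff)

lemma lin_scaleR: "lin \<gamma> u (c *\<^sub>R w) = c *\<^sub>R lin \<gamma> u w"
  by (simp add: lin_def prod_eq_iff algebra_simps)

lemma tendsto_lin:
  assumes "(f \<longlongrightarrow> w) F"
  shows "((\<lambda>n. lin \<gamma> u (f n)) \<longlongrightarrow> lin \<gamma> u w) F"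
  unfolding lin_def by (intro tendsto_intros assms)

lemma continuous_on_lin:
  assumes "continuous_on S f" "continuous_on S g"
  shows "continuous_on S (\<lambda>x. lin \<gamma> (f x) (g x))"
  unfolding lin_def by (intro continuous_intros assms)

text \<open>The chain rule. Along a solution it says that the translation mode \<open>U'\<close>
  solves the linearised equation.\<close>

lemma nonlin_has_vector_derivative:
  assumes "(V has_vector_derivative V') (at x)"
  shows "((\<lambda>x. nonlin \<gamma> (V x)) has_vector_derivative lin \<gamma> (V x) V') (at x)"
proof -
  have [derivative_intros]: "((\<lambda>x. fst (V x)) has_real_derivative fst V') (at x)"
    "((\<lambda>x. snd (V x)) has_real_derivative snd V') (at x)"
    using bounded_linear.has_vector_derivative[OF bounded_linear_fst assms]
      bounded_linear.has_vector_derivative[OF bounded_linear_snd assms]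
    by (simp_all add: has_real_derivative_iff_has_vector_derivative)
  show ?thesis
    unfolding nonlin_def lin_def
    by (intro has_vector_derivative_Pair)
      (auto simp: has_real_derivative_iff_has_vector_derivative[symmetric] power2_eq_square algebra_simps
        intro!: derivative_eq_intros)
qed

text \<open>Dropping the nonnegative term \<open>V' x \<bullet> V' x\<close> turns a vector equation
  into a scalar differential inequality for |V|^2.\<close>

lemma inner_self_derivs:
  fixes V :: "real \<Rightarrow> 'a::real_inner"
  assumes "(V has_vector_derivative V' x) (at x)" "(V' has_vector_derivative V'' x) (at x)"
  shows "((\<lambda>x. V x \<bullet> V x) has_real_derivative 2 * (V x \<bullet> V' x)) (at x)"
    "((\<lambda>x. 2 * (V x \<bullet> V' x)) has_real_derivative 2 * (V' x \<bullet> V' x + V x \<bullet> V'' x)) (at x)"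
  using bounded_bilinear.has_vector_derivative[OF bounded_bilinear_inner assms(1) assms(1)]
    bounded_bilinear.has_vector_derivative[OF bounded_bilinear_inner assms]
  by (auto simp: has_real_derivative_iff_has_vector_derivative[symmetric] inner_commute
    intro!: derivative_eq_intros)

section \<open>Polynomial bounds on the unit ball\<close>

lemma abs_mult_le:
  fixes x y :: real
  assumes "\<bar>x\<bar> \<le> a" "\<bar>y\<bar> \<le> b"
  shows "\<bar>x * y\<bar> \<le> a * b"
  unfolding abs_mult using assms by (intro mult_mono) auto

lemma norm_real_pair_le: "norm (p :: real \<times> real) \<le> \<bar>fst p\<bar> + \<bar>snd p\<bar>"
  using norm_Pair_le[of "fst p" "snd p"] by simp

lemma abs_components_le: "\<bar>fst (p :: real \<times> real)\<bar> \<le> norm p" "\<bar>snd (p :: real \<times> real)\<bar> \<le> norm p"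
  using norm_fst_le[of "fst p" "snd p"] norm_snd_le[of "snd p" "fst p"] by simp_all

lemma unit_square_components:
  assumes "norm (u :: real \<times> real) \<le> 1"
  shows "0 \<le> (fst u)\<^sup>2" "(fst u)\<^sup>2 \<le> 1" "0 \<le> (snd u)\<^sup>2" "(snd u)\<^sup>2 \<le> 1" "\<bar>fst u\<bar> \<le> 1" "\<bar>snd u\<bar> \<le> 1"
  using abs_components_le[of u] assms by (auto simp: abs_square_le_1)

text \<open>On the unit ball the diagonal entries of the Jacobian are at most
  \<open>4 + \<gamma>\<close> and the off-diagonal ones at most \<open>2 * \<gamma>\<close> in
  absolute value; the constant is the sum over all four entries.\<close>

lemma norm_lin_le:
  assumes \<gamma>: "\<gamma> > 1" and u: "norm u \<le> 1"
  shows "norm (lin \<gamma> u w) \<le> (8 + 6 * \<gamma>) * norm w"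
proof -
  note s = unit_square_components[OF u] and w = abs_components_le[of w]
  have g: "0 \<le> \<gamma> * (fst u)\<^sup>2" "\<gamma> * (fst u)\<^sup>2 \<le> \<gamma>" "0 \<le> \<gamma> * (snd u)\<^sup>2" "\<gamma> * (snd u)\<^sup>2 \<le> \<gamma>"
    using s \<gamma> by (auto simp: mult_le_cancel_left1)
  have 1: "\<bar>3 * (fst u)\<^sup>2 + \<gamma> * (snd u)\<^sup>2 - 1\<bar> \<le> 4 + \<gamma>" "\<bar>\<gamma> * (fst u)\<^sup>2 + 3 * (snd u)\<^sup>2 - 1\<bar> \<le> 4 + \<gamma>"
    using s g \<gamma> by linarith+
  have 2: "\<bar>2 * \<gamma> * fst u * snd u\<bar> \<le> 2 * \<gamma>"
    using abs_mult_le[OF abs_mult_le[OF order_refl[of "\<bar>2 * \<gamma>\<bar>"] s(5)] s(6)] \<gamma> by simp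
  have "norm (lin \<gamma> u w) \<le> \<bar>fst (lin \<gamma> u w)\<bar> + \<bar>snd (lin \<gamma> u w)\<bar>" by (rule norm_real_pair_le)
  also have "\<dots> \<le> ((4 + \<gamma>) * norm w + 2 * \<gamma> * norm w) + (2 * \<gamma> * norm w + (4 + \<gamma>) * norm w)"
    unfolding lin_def fst_conv snd_conv
    by (intro add_mono order_trans[OF abs_triangle_ineq] abs_mult_le 1 2 w)
  finally show ?thesis by (simp add: algebra_simps)
qed

text \<open>The difference splits into \<open>lin \<gamma> u (w - z)\<close> and the change of the
  coefficients from \<open>v\<close> to \<open>u\<close> applied to \<open>z\<close>; the
  coefficients are quadratic polynomials, hence Lipschitz on the unit ball.\<close>

lemma norm_lin_diff_le:
  assumes \<gamma>: "\<gamma> > 1" and u: "norm u \<le> 1" and v: "norm v \<le> 1" and z: "norm z \<le> 1"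
  shows "norm (lin \<gamma> u w - lin \<gamma> v z) \<le> (8 + 6 * \<gamma>) * norm (w - z) + (12 + 12 * \<gamma>) * norm (u - v)"
proof -
  note su = unit_square_components[OF u] and sv = unit_square_components[OF v]
    and sz = unit_square_components[OF z] and d = abs_components_le[of "u - v"]
  let ?d = "norm (u - v)"
  have p: "\<bar>fst u + fst v\<bar> \<le> 2" "\<bar>snd u + snd v\<bar> \<le> 2" using su sv by linarith+
  have sq: "\<bar>(fst u)\<^sup>2 - (fst v)\<^sup>2\<bar> \<le> 2 * ?d" "\<bar>(snd u)\<^sup>2 - (snd v)\<^sup>2\<bar> \<le> 2 * ?d"
    using abs_mult_le[OF p(1) d(1)] abs_mult_le[OF p(2) d(2)] by (simp_all add: power2_eq_square algebra_simps)
  have g: "\<bar>\<gamma> * ((fst u)\<^sup>2 - (fst v)\<^sup>2)\<bar> \<le> \<gamma> * (2 * ?d)" "\<bar>\<gamma> * ((snd u)\<^sup>2 - (snd v)\<^sup>2)\<bar> \<le> \<gamma> * (2 * ?d)"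
    using \<gamma> by (intro abs_mult_le sq; simp)+
  have 1: "\<bar>3 * ((fst u)\<^sup>2 - (fst v)\<^sup>2) + \<gamma> * ((snd u)\<^sup>2 - (snd v)\<^sup>2)\<bar> \<le> (6 + 2 * \<gamma>) * ?d"
    "\<bar>\<gamma> * ((fst u)\<^sup>2 - (fst v)\<^sup>2) + 3 * ((snd u)\<^sup>2 - (snd v)\<^sup>2)\<bar> \<le> (6 + 2 * \<gamma>) * ?d"
    using sq g by (auto simp: algebra_simps abs_le_iff)
  have "\<bar>fst u * (snd u - snd v) + (fst u - fst v) * snd v\<bar> \<le> 1 * ?d + ?d * 1"
    using d by (intro order_trans[OF abs_triangle_ineq] add_mono abs_mult_le su sv) auto
  then have 2: "\<bar>2 * \<gamma> * (fst u * snd u - fst v * snd v)\<bar> \<le> 2 * \<gamma> * (2 * ?d)"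
    using \<gamma> by (intro abs_mult_le) (auto simp: algebra_simps)
  have eq: "lin \<gamma> u w - lin \<gamma> v z = lin \<gamma> u (w - z) +
    ((3 * ((fst u)\<^sup>2 - (fst v)\<^sup>2) + \<gamma> * ((snd u)\<^sup>2 - (snd v)\<^sup>2)) * fst z + (2 * \<gamma> * (fst u * snd u - fst v * snd v)) * snd z,
     (2 * \<gamma> * (fst u * snd u - fst v * snd v)) * fst z + (\<gamma> * ((fst u)\<^sup>2 - (fst v)\<^sup>2) + 3 * ((snd u)\<^sup>2 - (snd v)\<^sup>2)) * snd z)"
    (is "_ = _ + ?r")
    by (simp add: lin_def prod_eq_iff algebra_simps)
  have "norm ?r \<le> ((6 + 2 * \<gamma>) * ?d * 1 + 2 * \<gamma> * (2 * ?d) * 1) + (2 * \<gamma> * (2 * ?d) * 1 + (6 + 2 * \<gamma>) * ?d * 1)"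
    by (rule order_trans[OF norm_real_pair_le], unfold fst_conv snd_conv)
      (intro add_mono order_trans[OF abs_triangle_ineq] abs_mult_le 1 2 sz)
  also have "\<dots> = (12 + 12 * \<gamma>) * ?d" by (simp add: algebra_simps)
  finally have "norm ?r \<le> (12 + 12 * \<gamma>) * ?d" .
  with norm_lin_le[OF \<gamma> u, of "w - z"] show ?thesis
    unfolding eq by (intro order_trans[OF norm_triangle_ineq] add_mono)
qed

text \<open>Removing value and linear part from a cubic polynomial leaves terms of degree two and
  three in \<open>w\<close>. Each is grouped as a quadratic monomial in \<open>w\<close> times a
  factor bounded on the unit balls.\<close>

lemma norm_nonlin_remainder_le:
  assumes \<gamma>: "\<gamma> > 1" and u: "norm u \<le> 1" and w: "norm w \<le> 1"
  shows "norm (nonlin \<gamma> (u + w) - nonlin \<gamma> u - lin \<gamma> u w) \<le> (8 + 8 * \<gamma>) * (norm w)\<^sup>2"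
proof -
  note su = unit_square_components[OF u] and sw = unit_square_components[OF w]
    and w' = abs_components_le[of w]
  let ?n = "(norm w)\<^sup>2"
  obtain u1 u2 w1 w2 where uw: "u = (u1, u2)" "w = (w1, w2)" by (metis surj_pair)
  have q: "\<bar>w1 * w1\<bar> \<le> ?n" "\<bar>w1 * w2\<bar> \<le> ?n" "\<bar>w2 * w2\<bar> \<le> ?n"
    unfolding power2_eq_square using w' uw by (intro abs_mult_le; simp)+
  have b: "\<bar>3 * u1 + w1\<bar> \<le> 4" "\<bar>3 * u2 + w2\<bar> \<le> 4" "\<bar>u1 + w1\<bar> \<le> 2" "\<bar>u2 + w2\<bar> \<le> 2" "\<bar>2 * u1\<bar> \<le> 2" "\<bar>2 * u2\<bar> \<le> 2"
    using su sw uw by auto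
  have eq: "nonlin \<gamma> (u + w) - nonlin \<gamma> u - lin \<gamma> u w =
    ((3 * u1 + w1) * (w1 * w1) + \<gamma> * ((u1 + w1) * (w2 * w2) + (2 * u2) * (w1 * w2)),
     (3 * u2 + w2) * (w2 * w2) + \<gamma> * ((u2 + w2) * (w1 * w1) + (2 * u1) * (w1 * w2)))"
    by (simp add: nonlin_def lin_def uw power2_eq_square algebra_simps)
  have "norm (nonlin \<gamma> (u + w) - nonlin \<gamma> u - lin \<gamma> u w) \<le>
      (4 * ?n + \<gamma> * (2 * ?n + 2 * ?n)) + (4 * ?n + \<gamma> * (2 * ?n + 2 * ?n))"
    unfolding eq
    by (rule order_trans[OF norm_real_pair_le], unfold fst_conv snd_conv)
      (use \<gamma> in \<open>intro add_mono order_trans[OF abs_triangle_ineq] abs_mult_le b q; simp\<close>)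
  then show ?thesis by (simp add: algebra_simps)
qed

lemma norm_nonlin_le:
  assumes \<gamma>: "\<gamma> > 1" and u: "norm u \<le> 1"
  shows "norm (nonlin \<gamma> u) \<le> 4 + 2 * \<gamma>"
proof -
  note s = unit_square_components[OF u]
  have g: "0 \<le> \<gamma> * (fst u)\<^sup>2" "\<gamma> * (fst u)\<^sup>2 \<le> \<gamma>" "0 \<le> \<gamma> * (snd u)\<^sup>2" "\<gamma> * (snd u)\<^sup>2 \<le> \<gamma>"
    using s \<gamma> by (auto simp: mult_le_cancel_left1)
  have "norm (nonlin \<gamma> u) \<le> (2 + \<gamma>) * 1 + (2 + \<gamma>) * 1"
    unfolding nonlin_def
    by (rule order_trans[OF norm_real_pair_le], unfold fst_conv snd_conv)
      (use s g \<gamma> in \<open>intro add_mono abs_mult_le; linarith\<close>)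
  then show ?thesis by simp
qed

text \<open>The two sides differ by 2(\<gamma> - 1) u1^2 u2^2. The lower bound is positive as soon
  as |u| > 1, as the maximum principle requires.\<close>

lemma inner_nonlin_ge:
  assumes "\<gamma> > 1" shows "u \<bullet> nonlin \<gamma> u \<ge> (u \<bullet> u)\<^sup>2 - u \<bullet> u"
proof -
  have "u \<bullet> nonlin \<gamma> u - ((u \<bullet> u)\<^sup>2 - u \<bullet> u) = 2 * (\<gamma> - 1) * (fst u * snd u)\<^sup>2"
    by (simp add: nonlin_def inner_prod_def power2_eq_square algebra_simps)
  moreover have "2 * (\<gamma> - 1) * (fst u * snd u)\<^sup>2 \<ge> 0" using assms by simp
  ultimately show ?thesis by linarith
qed

text \<open>Diagonal dominance: as 2|w1 w2| \<le> |w|^2, the off-diagonal terms take at most c/4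
  from the 3c/4 supplied by the diagonal.\<close>

lemma inner_lin_ge:
  assumes "3 * (fst u)\<^sup>2 + \<gamma> * (snd u)\<^sup>2 - 1 \<ge> 3 / 4 * c" "\<gamma> * (fst u)\<^sup>2 + 3 * (snd u)\<^sup>2 - 1 \<ge> 3 / 4 * c"
    and "\<bar>2 * \<gamma> * fst u * snd u\<bar> \<le> c / 4"
  shows "w \<bullet> lin \<gamma> u w \<ge> c / 2 * (w \<bullet> w)"
proof -
  define a b d where "a = 3 * (fst u)\<^sup>2 + \<gamma> * (snd u)\<^sup>2 - 1" and "b = 2 * \<gamma> * fst u * snd u"
    and "d = \<gamma> * (fst u)\<^sup>2 + 3 * (snd u)\<^sup>2 - 1"
  let ?x = "fst w" and ?y = "snd w"
  have "w \<bullet> lin \<gamma> u w = a * ?x\<^sup>2 + d * ?y\<^sup>2 + 2 * (b * (?x * ?y))"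
    by (simp add: lin_def inner_prod_def a_def b_def d_def power2_eq_square algebra_simps)
  moreover have "a * ?x\<^sup>2 \<ge> 3 / 4 * c * ?x\<^sup>2" "d * ?y\<^sup>2 \<ge> 3 / 4 * c * ?y\<^sup>2"
    using assms by (intro mult_right_mono; simp add: a_def d_def)+
  moreover have "\<bar>b * (?x * ?y)\<bar> \<le> c / 4 * ((?x\<^sup>2 + ?y\<^sup>2) / 2)"
  proof (rule abs_mult_le)
    show "\<bar>b\<bar> \<le> c / 4" using assms by (simp add: b_def)
    have "0 \<le> (?x - ?y)\<^sup>2" "0 \<le> (?x + ?y)\<^sup>2" by simp_all
    then show "\<bar>?x * ?y\<bar> \<le> (?x\<^sup>2 + ?y\<^sup>2) / 2"
      unfolding power2_sum power2_diff by (simp add: abs_le_iff field_simps)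
  qed
  moreover have "w \<bullet> w = ?x\<^sup>2 + ?y\<^sup>2" by (simp add: inner_prod_def power2_eq_square)
  ultimately show ?thesis by (simp add: algebra_simps)
qed

text \<open>Since |V|^2 tends to 1 at both ends, a value above 1 forces a global maximum above 1.
  There the second derivative of |V|^2 is positive by \<open>inner_nonlin_ge\<close>, which no
  maximum allows.\<close>

lemma norm_solution_le_1:
  assumes \<gamma>: "\<gamma> > 1"
    and V: "\<And>x. (V has_vector_derivative V' x) (at x)"
    and V': "\<And>x. (V' has_vector_derivative nonlin \<gamma> (V x)) (at x)"
    and lims: "(V \<longlongrightarrow> (1, 0)) at_top" "(V \<longlongrightarrow> (0, 1)) at_bot"
  shows "norm (V x) \<le> 1"
proof (rule ccontr)
  assume "\<not> norm (V x) \<le> 1"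
  define q where "q x = V x \<bullet> V x" for x
  have qx: "q x > 1"
    using \<open>\<not> norm (V x) \<le> 1\<close> unfolding q_def dot_square_norm by (simp add: one_less_power)
  note d = inner_self_derivs[where V''="\<lambda>x. nonlin \<gamma> (V x)", OF V V', folded q_def]
  have "(q \<longlongrightarrow> (1 :: real, 0 :: real) \<bullet> (1, 0)) at_top" "(q \<longlongrightarrow> (0 :: real, 1 :: real) \<bullet> (0, 1)) at_bot"
    unfolding q_def by (rule tendsto_inner lims)+
  then have "eventually (\<lambda>y. q y < q x) at_top" "eventually (\<lambda>y. q y < q x) at_bot"
    using qx by (auto dest: order_tendstoD(2)[where a="q x"])
  then obtain T S where T: "\<And>y. y \<ge> T \<Longrightarrow> q y < q x" and S: "\<And>y. y \<le> S \<Longrightarrow> q y < q x"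
    unfolding eventually_at_top_linorder eventually_at_bot_linorder by blast
  have ST: "S < x" "x < T" using T[of x] S[of x] by force+
  have "continuous_on {S..T} q" using d(1) DERIV_isCont continuous_at_imp_continuous_on by blast
  then obtain m where m: "m \<in> {S..T}" "\<And>y. y \<in> {S..T} \<Longrightarrow> q y \<le> q m"
    using continuous_attains_sup[of "{S..T}" q] ST by auto
  have qm: "q x \<le> q m" using m(2)[of x] ST by auto
  have max: "q y \<le> q m" for y
    using m(2)[of y] T[of y] S[of y] qm by (cases "y \<in> {S..T}") force+
  have "q m * (q m - 1) > 0" using qm qx by simp
  then have "V m \<bullet> nonlin \<gamma> (V m) > 0"
    using inner_nonlin_ge[OF \<gamma>, of "V m"] by (simp add: q_def power2_eq_square algebra_simps)
  then have "2 * (V' m \<bullet> V' m + V m \<bullet> nonlin \<gamma> (V m)) > 0" by (simp add: add_nonneg_pos)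
  from no_interior_max[OF d this] max show False by (meson not_le)
qed

section \<open>Differentiability of pointwise limits\<close>

lemma has_vector_derivative_of_quadratic_error:
  fixes f :: "real \<Rightarrow> 'a::real_normed_vector"
  assumes "\<And>y. norm (f y - f x - (y - x) *\<^sub>R D) \<le> N * \<bar>y - x\<bar>\<^sup>2"
  shows "(f has_vector_derivative D) (at x)"
  unfolding has_vector_derivative_def has_derivative_at_within
proof (intro conjI)
  show "bounded_linear (\<lambda>h. h *\<^sub>R D)" by (rule bounded_linear_scaleR_left)
  show "((\<lambda>y. (f y - f x - (y - x) *\<^sub>R D) /\<^sub>R norm (y - x)) \<longlongrightarrow> 0) (at x)"
  proof (rule Lim_null_comparison)
    have "((\<lambda>y. N * \<bar>y - x\<bar>) \<longlongrightarrow> N * \<bar>x - x\<bar>) (at x)" by (intro tendsto_intros)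
    then show "((\<lambda>y. N * \<bar>y - x\<bar>) \<longlongrightarrow> 0) (at x)" by simp
    show "\<forall>\<^sub>F y in at x. norm ((f y - f x - (y - x) *\<^sub>R D) /\<^sub>R norm (y - x)) \<le> N * \<bar>y - x\<bar>"
      using assms by (auto simp: eventually_at_filter power2_eq_square divide_simps mult.assoc)
  qed
qed

text \<open>The first-order remainder of \<open>f n\<close> is at most |y - x| (N |y - x| +
  \<delta>), a bound that survives pointwise limits and becomes quadratic. The error
  \<open>\<delta>\<close> admits second derivatives that are Lipschitz only up to a vanishing
  perturbation.\<close>

lemma has_vector_derivative_limit:
  fixes f :: "nat \<Rightarrow> real \<Rightarrow> 'a::real_normed_vector"
  assumes F: "F \<noteq> bot"
    and f: "\<And>x. ((\<lambda>n. f n x) \<longlongrightarrow> g x) F" and f': "((\<lambda>n. f' n x) \<longlongrightarrow> D) F"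
    and \<delta>: "(\<delta> \<longlongrightarrow> 0) F"
    and d: "\<And>n x. (f n has_vector_derivative f' n x) (at x)"
    and osc: "\<And>n z. norm (f' n z - f' n x) \<le> N * \<bar>z - x\<bar> + \<delta> n" and N: "N \<ge> 0"
  shows "(g has_vector_derivative D) (at x)"
proof (rule has_vector_derivative_of_quadratic_error)
  fix y
  have "norm (f n y - f n x - (y - x) *\<^sub>R f' n x) \<le> \<bar>y - x\<bar> * (N * \<bar>y - x\<bar> + \<delta> n)" for n
  proof (rule first_order_remainder[where S="closed_segment x y", OF d])
    fix z assume "z \<in> closed_segment x y"
    then have "N * \<bar>z - x\<bar> \<le> N * \<bar>y - x\<bar>"
      using N by (intro mult_left_mono) (auto simp: closed_segment_eq_real_ivl split: if_splits)
    then show "norm (f' n z - f' n x) \<le> N * \<bar>y - x\<bar> + \<delta> n" using osc[of n z] by linarith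
  qed auto
  moreover have "((\<lambda>n. norm (f n y - f n x - (y - x) *\<^sub>R f' n x)) \<longlongrightarrow> norm (g y - g x - (y - x) *\<^sub>R D)) F"
    by (intro tendsto_intros f f')
  moreover have "((\<lambda>n. \<bar>y - x\<bar> * (N * \<bar>y - x\<bar> + \<delta> n)) \<longlongrightarrow> \<bar>y - x\<bar> * (N * \<bar>y - x\<bar> + 0)) F"
    by (intro tendsto_intros \<delta>)
  ultimately have "norm (g y - g x - (y - x) *\<^sub>R D) \<le> \<bar>y - x\<bar> * (N * \<bar>y - x\<bar> + 0)"
    using F by (intro tendsto_le[OF F]) auto
  then show "norm (g y - g x - (y - x) *\<^sub>R D) \<le> N * \<bar>y - x\<bar>\<^sup>2"
    by (simp add: power2_eq_square algebra_simps)
qed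

subsection \<open>Rigidity of the domain wall\<close>

text \<open>Formulated for a generic solution joining the two limits, so that the same bounds apply
  to \<open>U\<close> and to the competitor \<open>V\<close>.\<close>

locale domain_wall =
  fixes \<gamma> :: real and U U' :: "real \<Rightarrow> real \<times> real"
  assumes \<gamma>: "\<gamma> > 1"
    and U: "\<And>x. (U has_vector_derivative U' x) (at x)"
    and U': "\<And>x. (U' has_vector_derivative nonlin \<gamma> (U x)) (at x)"
    and U_lims: "(U \<longlongrightarrow> (1, 0)) at_top" "(U \<longlongrightarrow> (0, 1)) at_bot"
begin

lemma norm_U_le: "norm (U x) \<le> 1"
  using norm_solution_le_1[OF \<gamma> U U' U_lims] .

lemma norm_U'_le: "norm (U' x) \<le> 6 + 2 * \<gamma>"
  using norm_derivative_le[OF U U', of x 1 "4 + 2 * \<gamma>"] norm_U_le norm_nonlin_le[OF \<gamma>] by auto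

lemma continuous_U: "continuous_on UNIV U"
  by (rule has_vector_derivative_imp_continuous_on[OF U])

lemma coercive:
  obtains a R where "a > 0" "R \<ge> 0" "\<And>x w. \<bar>x\<bar> \<ge> R \<Longrightarrow> w \<bullet> lin \<gamma> (U x) w \<ge> 2 * a * (w \<bullet> w)"
proof -
  \<comment> \<open>At both limits of \<open>U\<close> the Jacobian is diagonal with entries
    \<open>2\<close> and \<open>\<gamma> - 1\<close>. Near the limits, three quarters of the smaller
    entry survive on the diagonal and the off-diagonal entry is below \<open>c / 4\<close>.\<close>
  define c where "c = min 2 (\<gamma> - 1)"
  have c: "c > 0" "3 / 4 * c < 2" "3 / 4 * c < \<gamma> - 1" using \<gamma> by (auto simp: c_def min_def)
  let ?P = "\<lambda>u. 3 * (fst u)\<^sup>2 + \<gamma> * (snd u)\<^sup>2 - 1 > 3 / 4 * c \<and>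
      \<gamma> * (fst u)\<^sup>2 + 3 * (snd u)\<^sup>2 - 1 > 3 / 4 * c \<and> \<bar>2 * \<gamma> * fst u * snd u\<bar> < c / 4"
  have t: "eventually (\<lambda>x. ?P (U x)) F" if U: "(U \<longlongrightarrow> e) F" and e: "?P e" for F e
  proof -
    have l: "((\<lambda>x. 3 * (fst (U x))\<^sup>2 + \<gamma> * (snd (U x))\<^sup>2 - 1) \<longlongrightarrow> 3 * (fst e)\<^sup>2 + \<gamma> * (snd e)\<^sup>2 - 1) F"
      "((\<lambda>x. \<gamma> * (fst (U x))\<^sup>2 + 3 * (snd (U x))\<^sup>2 - 1) \<longlongrightarrow> \<gamma> * (fst e)\<^sup>2 + 3 * (snd e)\<^sup>2 - 1) F"
      "((\<lambda>x. \<bar>2 * \<gamma> * fst (U x) * snd (U x)\<bar>) \<longlongrightarrow> \<bar>2 * \<gamma> * fst e * snd e\<bar>) F"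
      by (intro tendsto_intros U)+
    show ?thesis
      by (intro eventually_conj order_tendstoD(1)[OF l(1)] order_tendstoD(1)[OF l(2)] order_tendstoD(2)[OF l(3)])
        (use e in auto)
  qed
  have "eventually (\<lambda>x. ?P (U x)) at_top" "eventually (\<lambda>x. ?P (U x)) at_bot"
    using t[OF U_lims(1)] t[OF U_lims(2)] c by auto
  then obtain T S where T: "\<And>x. x \<ge> T \<Longrightarrow> ?P (U x)" and S: "\<And>x. x \<le> S \<Longrightarrow> ?P (U x)"
    unfolding eventually_at_top_linorder eventually_at_bot_linorder by blast
  define R where "R = max 0 (max T (- S))"
  have "w \<bullet> lin \<gamma> (U x) w \<ge> 2 * (c / 4) * (w \<bullet> w)" if "\<bar>x\<bar> \<ge> R" for x w
  proof -
    have "x \<ge> T \<or> x \<le> S" using that by (auto simp: R_def)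
    then have "?P (U x)" using T S by blast
    then have "w \<bullet> lin \<gamma> (U x) w \<ge> c / 2 * (w \<bullet> w)" by (intro inner_lin_ge) auto
    then show ?thesis by simp
  qed
  then show ?thesis using that[of "c / 4" R] c by (simp add: R_def)
qed

text \<open>By coercivity |Z|^2 is a subsolution away from a compact interval, so mere boundedness
  improves to exponential decay. The equation passes the decay to the second derivative, and
  \<open>norm_derivative_le\<close> to the first.\<close>

lemma bounded_kernel:
  assumes Z: "\<And>x. (Z has_vector_derivative Z' x) (at x)"
    and Z': "\<And>x. (Z' has_vector_derivative lin \<gamma> (U x) (Z x)) (at x)"
    and bnd: "\<And>x. norm (Z x) \<le> M"
  shows "Z \<in> H2" "ae_eq (L_plus \<gamma> U Z) (\<lambda>x. 0 *\<^sub>R Z x)"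
proof -
  from coercive obtain a R where a: "a > 0" and R: "R \<ge> 0"
    and co: "\<And>x w. \<bar>x\<bar> \<ge> R \<Longrightarrow> w \<bullet> lin \<gamma> (U x) w \<ge> 2 * a * (w \<bullet> w)" by blast
  have cZ: "continuous_on UNIV Z" "continuous_on UNIV Z'"
    by (rule has_vector_derivative_imp_continuous_on[OF Z] has_vector_derivative_imp_continuous_on[OF Z'])+
  have cZ'': "continuous_on UNIV (\<lambda>x. lin \<gamma> (U x) (Z x))" by (intro continuous_on_lin continuous_U cZ)
  have "ae_eq (weak_deriv (weak_deriv Z)) (\<lambda>x. lin \<gamma> (U x) (Z x))"
    by (rule weak_deriv_weak_deriv_C2[OF Z Z' cZ''])
  then show "ae_eq (L_plus \<gamma> U Z) (\<lambda>x. 0 *\<^sub>R Z x)"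
    unfolding ae_eq_def by eventually_elim (simp add: L_plus_eq)
  define \<kappa> where "\<kappa> = sqrt a"
  have \<kappa>: "\<kappa> > 0" "\<kappa>\<^sup>2 = a" using a by (auto simp: \<kappa>_def)
  define q where "q x = Z x \<bullet> Z x" for x
  note d = inner_self_derivs[where V''="\<lambda>x. lin \<gamma> (U x) (Z x)", OF Z Z', folded q_def]
  have M: "M \<ge> 0" using bnd norm_ge_zero order_trans by blast
  have q_eq: "q x = (norm (Z x))\<^sup>2" for x by (simp add: q_def dot_square_norm)
  have q: "0 \<le> q x" "q x \<le> M\<^sup>2" for x
    using bnd[of x] by (auto simp: q_eq intro: power_mono)
  have decay: "q x \<le> M\<^sup>2 * exp (\<kappa> * (R - \<bar>x\<bar>))" for x
  proof (cases "\<bar>x\<bar> \<ge> R")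
    case True
    have "q x \<le> max (q R) (q (- R)) * exp (\<kappa> * (R - \<bar>x\<bar>))"
    proof (rule bounded_subsolution_decay[OF \<kappa>(1) d _ q R True])
      fix y assume y: "\<bar>y\<bar> \<ge> R"
      have "Z y \<bullet> lin \<gamma> (U y) (Z y) \<ge> 2 * (a * q y)" using co[OF y, of "Z y"] by (simp add: q_def)
      moreover have "a * q y \<ge> 0" using a q by simp
      ultimately have "a * q y \<le> 2 * (Z y \<bullet> lin \<gamma> (U y) (Z y))" by linarith
      then have "a * q y \<le> 2 * (Z' y \<bullet> Z' y + Z y \<bullet> lin \<gamma> (U y) (Z y))"
        using inner_ge_zero[of "Z' y"] unfolding distrib_left by linarith
      then show "\<kappa>\<^sup>2 * q y \<le> 2 * (Z' y \<bullet> Z' y + Z y \<bullet> lin \<gamma> (U y) (Z y))" by (simp add: \<kappa>)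
    qed
    also have "\<dots> \<le> M\<^sup>2 * exp (\<kappa> * (R - \<bar>x\<bar>))" using q by (intro mult_right_mono) auto
    finally show ?thesis .
  next
    case False
    then have "1 \<le> exp (\<kappa> * (R - \<bar>x\<bar>))" using \<kappa> by simp
    then have "M\<^sup>2 * 1 \<le> M\<^sup>2 * exp (\<kappa> * (R - \<bar>x\<bar>))" by (intro mult_left_mono) auto
    with q[of x] show ?thesis by simp
  qed
  \<comment> \<open>Passing from |Z|^2 to |Z| halves the rate; \<open>C\<close> absorbs the shift by
    \<open>R\<close>.\<close>
  define c where "c = \<kappa> / 2"
  define C where "C = M * exp (c * R)"
  have c: "c > 0" and C: "C \<ge> 0" using \<kappa> M by (auto simp: c_def C_def)
  have Z_le: "norm (Z x) \<le> C * exp (- c * \<bar>x\<bar>)" for x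
  proof -
    have eq: "C * exp (- c * \<bar>x\<bar>) = M * exp (c * (R - \<bar>x\<bar>))"
      by (simp add: C_def right_diff_distrib exp_diff exp_minus divide_inverse)
    have "(norm (Z x))\<^sup>2 \<le> M\<^sup>2 * exp (2 * (c * (R - \<bar>x\<bar>)))"
      using decay[of x] by (simp add: q_eq c_def)
    also have "\<dots> = (C * exp (- c * \<bar>x\<bar>))\<^sup>2"
      unfolding eq exp_double by (simp add: power_mult_distrib)
    finally show ?thesis by (rule power2_le_imp_le) (use C in simp)
  qed
  define K where "K = 8 + 6 * \<gamma>"
  have K: "K \<ge> 0" using \<gamma> by (simp add: K_def)
  have Z''_le: "norm (lin \<gamma> (U x) (Z x)) \<le> (K * C) * exp (- c * \<bar>x\<bar>)" for x
  proof -
    have "norm (lin \<gamma> (U x) (Z x)) \<le> K * norm (Z x)" unfolding K_def by (rule norm_lin_le[OF \<gamma> norm_U_le])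
    also have "\<dots> \<le> K * (C * exp (- c * \<bar>x\<bar>))" by (intro mult_left_mono Z_le K)
    finally show ?thesis by simp
  qed
  have Z'_le: "norm (Z' x) \<le> ((2 * C + K * C) * exp c) * exp (- c * \<bar>x\<bar>)" for x
  proof -
    \<comment> \<open>Across the unit interval used by \<open>norm_derivative_le\<close> the weight
      varies by a factor of at most \<open>exp c\<close>.\<close>
    have e: "exp (- c * \<bar>y\<bar>) \<le> exp c * exp (- c * \<bar>x\<bar>)" if "x \<le> y" "y \<le> x + 1" for y
    proof -
      have "c * \<bar>x\<bar> \<le> c * (1 + \<bar>y\<bar>)" using that c by (intro mult_left_mono) auto
      then show ?thesis by (simp add: exp_add[symmetric] algebra_simps)
    qed
    have "norm (Z' x) \<le> 2 * (C * (exp c * exp (- c * \<bar>x\<bar>))) + (K * C) * (exp c * exp (- c * \<bar>x\<bar>))"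
      using C K by (intro norm_derivative_le[OF Z Z'] order_trans[OF Z_le] order_trans[OF Z''_le]
          mult_left_mono e mult_nonneg_nonneg) auto
    then show ?thesis by (simp add: algebra_simps)
  qed
  have "Z \<in> L2" "Z' \<in> L2" "(\<lambda>x. lin \<gamma> (U x) (Z x)) \<in> L2"
    by (rule L2_exp_decay[OF c] cZ cZ'' Z_le Z'_le Z''_le)+
  moreover have "Z has_weak_deriv Z'" "Z' has_weak_deriv (\<lambda>x. lin \<gamma> (U x) (Z x))"
    using has_weak_deriv_C1[OF Z cZ(2)] has_weak_deriv_C1[OF Z' cZ''] .
  ultimately show "Z \<in> H2" unfolding H2_def by blast
qed

text \<open>Both \<open>Z\<close> and \<open>U'\<close> are bounded solutions of the linearised
  equation, hence almost everywhere multiples of one kernel element. By continuity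
  \<open>b *\<^sub>R Z x = c *\<^sub>R U' x\<close> everywhere, with \<open>b \<noteq> 0\<close>
  because \<open>U'\<close> is nonzero; the product with \<open>U' x0\<close> at \<open>x0\<close>
  gives \<open>c = 0\<close>.\<close>

lemma simple_kernel:
  assumes simple: "simple_eigenvalue H2 (L_plus \<gamma> U) 0" and x0: "U' x0 \<noteq> 0"
    and Z: "\<And>x. (Z has_vector_derivative Z' x) (at x)"
    and Z': "\<And>x. (Z' has_vector_derivative lin \<gamma> (U x) (Z x)) (at x)"
    and bnd: "\<And>x. norm (Z x) \<le> M" and orth: "Z x0 \<bullet> U' x0 = 0"
  shows "Z x = 0"
proof -
  have cont: "continuous_on UNIV Z" "continuous_on UNIV U'"
    by (rule has_vector_derivative_imp_continuous_on[OF Z] has_vector_derivative_imp_continuous_on[OF U'])+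
  from simple obtain W where W: "\<And>Z. Z \<in> H2 \<Longrightarrow> ae_eq (L_plus \<gamma> U Z) (\<lambda>x. 0 *\<^sub>R Z x) \<Longrightarrow> \<exists>c. ae_eq Z (\<lambda>x. c *\<^sub>R W x)"
    unfolding simple_eigenvalue_def by blast
  obtain c where c: "ae_eq Z (\<lambda>x. c *\<^sub>R W x)" using W bounded_kernel[OF Z Z' bnd] by blast
  obtain b where b: "ae_eq U' (\<lambda>x. b *\<^sub>R W x)"
    using W bounded_kernel[OF U' nonlin_has_vector_derivative[OF U] norm_U'_le] by blast
  have "ae_eq (\<lambda>x. b *\<^sub>R Z x) (\<lambda>x. c *\<^sub>R U' x)"
    using c b unfolding ae_eq_def by eventually_elim simp
  then have eq: "(\<lambda>x. b *\<^sub>R Z x) = (\<lambda>x. c *\<^sub>R U' x)"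
    by (rule ae_eq_continuous) (intro continuous_intros cont)+
  have "b \<noteq> 0"
  proof
    assume "b = 0"
    then have "ae_eq U' (\<lambda>x. 0)" using b by simp
    then have "U' = (\<lambda>x. 0)" by (rule ae_eq_continuous) (intro continuous_intros cont)+
    then show False using x0 by simp
  qed
  have "c * (U' x0 \<bullet> U' x0) = b * (Z x0 \<bullet> U' x0)"
    using fun_cong[OF eq, of x0] by (metis inner_scaleR_left)
  then have "c = 0" using orth x0 by simp
  with fun_cong[OF eq, of x] \<open>b \<noteq> 0\<close> show ?thesis by simp
qed

text \<open>The constants are fixed before \<open>V\<close>, so the estimates are uniform in
  \<open>V\<close>. For small \<open>\<epsilon>\<close> half of the coercivity absorbs the quadratic
  remainder, so |V - U|^2 is a subsolution outside \<open>{-R..R}\<close> and attains its supremum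
  inside; dividing by the maximal norm gives \<open>\<Phi>\<close>.\<close>

lemma normalised_difference:
  obtains \<epsilon>0 R C where "\<epsilon>0 > 0" "\<epsilon>0 \<le> 1" "C \<ge> 0"
    "\<And>V V' \<epsilon> v x0. (\<And>x. (V has_vector_derivative V' x) (at x)) \<Longrightarrow>
      (\<And>x. (V' has_vector_derivative nonlin \<gamma> (V x)) (at x)) \<Longrightarrow>
      (\<And>x. norm (V x - U x) \<le> \<epsilon>) \<Longrightarrow> \<epsilon> \<le> \<epsilon>0 \<Longrightarrow> V \<noteq> U \<Longrightarrow> (V x0 - U x0) \<bullet> v = 0 \<Longrightarrow>
      \<exists>\<Phi> \<Phi>' \<Phi>'' t. (\<forall>x. (\<Phi> has_vector_derivative \<Phi>' x) (at x)) \<and>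
        (\<forall>x. (\<Phi>' has_vector_derivative \<Phi>'' x) (at x)) \<and> (\<forall>x. norm (\<Phi> x) \<le> 1) \<and>
        \<bar>t\<bar> \<le> R \<and> norm (\<Phi> t) = 1 \<and> \<Phi> x0 \<bullet> v = 0 \<and>
        (\<forall>x. norm (\<Phi>'' x - lin \<gamma> (U x) (\<Phi> x)) \<le> C * \<epsilon>)"
proof -
  from coercive obtain a R where a: "a > 0" and R: "R \<ge> 0"
    and co: "\<And>x w. \<bar>x\<bar> \<ge> R \<Longrightarrow> w \<bullet> lin \<gamma> (U x) w \<ge> 2 * a * (w \<bullet> w)" by blast
  define \<kappa> where "\<kappa> = sqrt a"
  have \<kappa>: "\<kappa> > 0" "\<kappa>\<^sup>2 = a" using a by (auto simp: \<kappa>_def)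
  define C where "C = 8 + 8 * \<gamma>"
  have C: "C > 0" using \<gamma> by (simp add: C_def)
  \<comment> \<open>The bound 1 is required by the remainder estimate, and
    \<open>C * \<epsilon>0 \<le> a\<close> lets one of the two units of \<open>a\<close> in
    \<open>co\<close> absorb the remainder.\<close>
  define \<epsilon>0 where "\<epsilon>0 = min 1 (a / C)"
  have \<epsilon>0: "\<epsilon>0 > 0" "\<epsilon>0 \<le> 1" "C * \<epsilon>0 \<le> a" using a C by (auto simp: \<epsilon>0_def min_def field_simps)
  show thesis
  proof (rule that[OF \<epsilon>0(1,2), of C R])
    show "C \<ge> 0" using C by simp
    fix V V' \<epsilon> v x0
    assume V: "\<And>x. (V has_vector_derivative V' x) (at x)"
      and V': "\<And>x. (V' has_vector_derivative nonlin \<gamma> (V x)) (at x)"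
      and close: "\<And>x. norm (V x - U x) \<le> \<epsilon>" and \<epsilon>: "\<epsilon> \<le> \<epsilon>0" and ne: "V \<noteq> U"
      and orth: "(V x0 - U x0) \<bullet> v = 0"
    define W where "W x = V x - U x" for x
    define W' where "W' x = V' x - U' x" for x
    define W'' where "W'' x = nonlin \<gamma> (V x) - nonlin \<gamma> (U x)" for x
    have W: "(W has_vector_derivative W' x) (at x)" "(W' has_vector_derivative W'' x) (at x)" for x
      unfolding W_def W'_def W''_def by (intro has_vector_derivative_diff V V' U U')+
    have W_le: "norm (W x) \<le> \<epsilon>" for x using close by (simp add: W_def)
    have rem: "norm (W'' x - lin \<gamma> (U x) (W x)) \<le> C * (norm (W x))\<^sup>2" for x
      using norm_nonlin_remainder_le[OF \<gamma> norm_U_le, of "W x" x] W_le[of x] \<epsilon> \<epsilon>0(2)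
      by (simp add: W_def W''_def C_def)
    define q where "q x = W x \<bullet> W x" for x
    note d = inner_self_derivs[where V=W and V'=W' and V''=W'', OF W, folded q_def]
    have q_eq: "q x = (norm (W x))\<^sup>2" for x by (simp add: q_def dot_square_norm)
    have q: "0 \<le> q x" "q x \<le> \<epsilon>\<^sup>2" for x
      using W_le[of x] by (auto simp: q_eq intro: power_mono)
    have sub: "\<kappa>\<^sup>2 * q y \<le> 2 * (W' y \<bullet> W' y + W y \<bullet> W'' y)" if y: "\<bar>y\<bar> \<ge> R" for y
    proof -
      have "\<bar>W y \<bullet> (W'' y - lin \<gamma> (U y) (W y))\<bar> \<le> norm (W y) * norm (W'' y - lin \<gamma> (U y) (W y))"
        by (rule Cauchy_Schwarz_ineq2)
      also have "\<dots> \<le> \<epsilon>0 * (C * (norm (W y))\<^sup>2)"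
        using W_le[of y] \<epsilon> \<epsilon>0(1) by (intro mult_mono rem) auto
      also have "\<dots> = (C * \<epsilon>0) * q y" by (simp add: q_eq)
      also have "\<dots> \<le> a * q y" using \<epsilon>0(3) q by (intro mult_right_mono) auto
      finally have "W y \<bullet> (W'' y - lin \<gamma> (U y) (W y)) \<ge> - (a * q y)" by linarith
      moreover have "W y \<bullet> lin \<gamma> (U y) (W y) \<ge> 2 * (a * q y)" using co[OF y, of "W y"] by (simp add: q_def)
      ultimately have "W y \<bullet> W'' y \<ge> a * q y" by (simp add: inner_diff_right)
      moreover have "a * q y \<ge> 0" using a q by simp
      ultimately have "a * q y \<le> 2 * (W y \<bullet> W'' y)" by linarith
      then show ?thesis using inner_ge_zero[of "W' y"] unfolding \<kappa> distrib_left by linarith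
    qed
    have "continuous_on {-R..R} q" using d(1) DERIV_isCont continuous_at_imp_continuous_on by blast
    then obtain t where t: "t \<in> {-R..R}" "\<And>y. y \<in> {-R..R} \<Longrightarrow> q y \<le> q t"
      using continuous_attains_sup[of "{-R..R}" q] R by auto
    have q_le: "q x \<le> q t" for x
    proof (cases "\<bar>x\<bar> \<ge> R")
      case True
      have "q x \<le> max (q R) (q (- R)) * exp (\<kappa> * (R - \<bar>x\<bar>))"
        by (rule bounded_subsolution_decay[OF \<kappa>(1) d sub q R True])
      \<comment> \<open>The points \<open>R\<close> and \<open>- R\<close> lie in the compact
        interval, and the exponential is at most 1 beyond it.\<close>
      also have "\<dots> \<le> q t * 1"
        using t(2)[of R] t(2)[of "- R"] R q \<kappa> True by (intro mult_mono) (auto simp: mult_nonneg_nonpos)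
      finally show ?thesis by simp
    next
      case False
      then have "x \<in> {-R..R}" by auto
      then show ?thesis by (rule t(2))
    qed
    define m where "m = norm (W t)"
    have W_le_m: "norm (W x) \<le> m" for x
      using q_le[of x] unfolding q_eq m_def by (simp add: power2_le_iff_abs_le)
    have m: "m > 0"
    proof (rule ccontr)
      assume "\<not> m > 0"
      then have "W x = 0" for x using W_le_m[of x] norm_le_zero_iff[of "W x"] by linarith
      then show False using ne by (auto simp: W_def)
    qed
    show "\<exists>\<Phi> \<Phi>' \<Phi>'' t. (\<forall>x. (\<Phi> has_vector_derivative \<Phi>' x) (at x)) \<and>
        (\<forall>x. (\<Phi>' has_vector_derivative \<Phi>'' x) (at x)) \<and> (\<forall>x. norm (\<Phi> x) \<le> 1) \<and>
        \<bar>t\<bar> \<le> R \<and> norm (\<Phi> t) = 1 \<and> \<Phi> x0 \<bullet> v = 0 \<and>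
        (\<forall>x. norm (\<Phi>'' x - lin \<gamma> (U x) (\<Phi> x)) \<le> C * \<epsilon>)"
    proof (intro exI conjI allI)
      show "((\<lambda>x. (1 / m) *\<^sub>R W x) has_vector_derivative (1 / m) *\<^sub>R W' x) (at x)"
        "((\<lambda>x. (1 / m) *\<^sub>R W' x) has_vector_derivative (1 / m) *\<^sub>R W'' x) (at x)" for x
        using bounded_linear.has_vector_derivative[OF bounded_linear_scaleR_right W(1)]
          bounded_linear.has_vector_derivative[OF bounded_linear_scaleR_right W(2)] by blast+
      show "norm ((1 / m) *\<^sub>R W x) \<le> 1" for x using W_le_m[of x] m by (simp add: field_simps)
      show "\<bar>t\<bar> \<le> R" using t by auto
      show "norm ((1 / m) *\<^sub>R W t) = 1" using m by (simp add: m_def)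
      show "((1 / m) *\<^sub>R W x0) \<bullet> v = 0" using orth by (simp add: W_def)
      fix x
      have "norm ((1 / m) *\<^sub>R W'' x - lin \<gamma> (U x) ((1 / m) *\<^sub>R W x)) = (1 / m) * norm (W'' x - lin \<gamma> (U x) (W x))"
        using m by (simp add: lin_scaleR flip: scaleR_diff_right)
      also have "\<dots> \<le> (1 / m) * (C * (m * \<epsilon>))"
      proof -
        \<comment> \<open>One factor is bounded by \<open>m\<close>, which the normalisation
          cancels; the other keeps the smallness \<open>\<epsilon>\<close>.\<close>
        have "(norm (W x))\<^sup>2 \<le> m * \<epsilon>" unfolding power2_eq_square using W_le_m[of x] W_le[of x] m by (intro mult_mono) auto
        then show ?thesis using rem[of x] m C by (intro mult_left_mono) (auto intro: order_trans)
      qed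
      also have "\<dots> = C * \<epsilon>" using m by simp
      finally show "norm ((1 / m) *\<^sub>R W'' x - lin \<gamma> (U x) ((1 / m) *\<^sub>R W x)) \<le> C * \<epsilon>" .
    qed
  qed
qed

end

lemma has_vector_derivative_translate:
  assumes "\<And>x. (f has_vector_derivative f' x) (at x)"
  shows "((\<lambda>x. f (x + c)) has_vector_derivative f' (x + c)) (at x)"
proof -
  have "((\<lambda>x. x + c) has_vector_derivative 1) (at x)"
    by (auto intro!: derivative_eq_intros simp flip: has_real_derivative_iff_has_vector_derivative)
  from vector_diff_chain_at[OF this assms] show ?thesis by (simp add: o_def)
qed

context domain_wall
begin

text \<open>The normalised differences and their first derivatives are uniformly bounded and
  equi-Lipschitz, and their second derivatives are so up to a vanishing error, so a cluster point
  solves the linearised equation. Since the norm 1 is attained at points of a fixed compact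
  interval, the limit is not zero.\<close>

lemma linearised_limit:
  assumes approx: "\<And>\<epsilon>. \<epsilon> > 0 \<Longrightarrow> \<exists>V V'. (\<forall>x. (V has_vector_derivative V' x) (at x)) \<and>
      (\<forall>x. (V' has_vector_derivative nonlin \<gamma> (V x)) (at x)) \<and>
      (\<forall>x. norm (V x - U x) \<le> \<epsilon>) \<and> (V x0 - U x0) \<bullet> v = 0 \<and> V \<noteq> U"
  obtains Z Z' \<tau> where "\<And>x. (Z has_vector_derivative Z' x) (at x)"
    "\<And>x. (Z' has_vector_derivative lin \<gamma> (U x) (Z x)) (at x)"
    "\<And>x. norm (Z x) \<le> 1" "Z x0 \<bullet> v = 0" "Z \<tau> \<noteq> 0"
proof (rule normalised_difference)
  fix \<epsilon>0 R C :: real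
  assume \<epsilon>0: "\<epsilon>0 > 0" "\<epsilon>0 \<le> 1" and C: "C \<ge> 0"
    and norm: "\<And>V V' \<epsilon> v x0. (\<And>x. (V has_vector_derivative V' x) (at x)) \<Longrightarrow>
      (\<And>x. (V' has_vector_derivative nonlin \<gamma> (V x)) (at x)) \<Longrightarrow>
      (\<And>x. norm (V x - U x) \<le> \<epsilon>) \<Longrightarrow> \<epsilon> \<le> \<epsilon>0 \<Longrightarrow> V \<noteq> U \<Longrightarrow> (V x0 - U x0) \<bullet> v = 0 \<Longrightarrow>
      \<exists>\<Phi> \<Phi>' \<Phi>'' t. (\<forall>x. (\<Phi> has_vector_derivative \<Phi>' x) (at x)) \<and>
        (\<forall>x. (\<Phi>' has_vector_derivative \<Phi>'' x) (at x)) \<and> (\<forall>x. norm (\<Phi> x) \<le> 1) \<and>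
        \<bar>t\<bar> \<le> R \<and> norm (\<Phi> t) = 1 \<and> \<Phi> x0 \<bullet> v = 0 \<and>
        (\<forall>x. norm (\<Phi>'' x - lin \<gamma> (U x) (\<Phi> x)) \<le> C * \<epsilon>)"
  define \<epsilon> where "\<epsilon> n = \<epsilon>0 / real (Suc n)" for n
  have \<epsilon>: "\<epsilon> n > 0" "\<epsilon> n \<le> \<epsilon>0" "\<epsilon> n \<le> 1" for n
  proof -
    show "\<epsilon> n > 0" using \<epsilon>0 by (simp add: \<epsilon>_def)
    have "\<epsilon>0 * 1 \<le> \<epsilon>0 * real (Suc n)" using \<epsilon>0 by (intro mult_left_mono) auto
    then show "\<epsilon> n \<le> \<epsilon>0" by (simp add: \<epsilon>_def divide_simps)
    then show "\<epsilon> n \<le> 1" using \<epsilon>0 by simp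
  qed
  have \<epsilon>_lim: "\<epsilon> \<longlonglongrightarrow> 0"
    unfolding \<epsilon>_def using lim_const_over_n[of \<epsilon>0] by (rule LIMSEQ_Suc)
  have "\<exists>\<Phi> \<Phi>' \<Phi>'' t. (\<forall>x. (\<Phi> has_vector_derivative \<Phi>' x) (at x)) \<and>
        (\<forall>x. (\<Phi>' has_vector_derivative \<Phi>'' x) (at x)) \<and> (\<forall>x. norm (\<Phi> x) \<le> 1) \<and>
        \<bar>t\<bar> \<le> R \<and> norm (\<Phi> t) = 1 \<and> \<Phi> x0 \<bullet> v = 0 \<and>
        (\<forall>x. norm (\<Phi>'' x - lin \<gamma> (U x) (\<Phi> x)) \<le> C * \<epsilon> n)" for n
  proof -
    from approx[OF \<epsilon>(1)[of n]] obtain V V' where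
      V: "\<And>x. (V has_vector_derivative V' x) (at x)"
      "\<And>x. (V' has_vector_derivative nonlin \<gamma> (V x)) (at x)"
      "\<And>x. norm (V x - U x) \<le> \<epsilon> n" "(V x0 - U x0) \<bullet> v = 0" "V \<noteq> U" by blast
    show ?thesis by (rule norm[OF V(1-3) \<epsilon>(2) V(5,4)])
  qed
  then obtain \<Phi> \<Phi>' \<Phi>'' t where
    \<Phi>: "\<And>n x. (\<Phi> n has_vector_derivative \<Phi>' n x) (at x)"
    and \<Phi>': "\<And>n x. (\<Phi>' n has_vector_derivative \<Phi>'' n x) (at x)"
    and \<Phi>_le: "\<And>n x. norm (\<Phi> n x) \<le> 1"
    and t: "\<And>n. \<bar>t n\<bar> \<le> R" "\<And>n. norm (\<Phi> n (t n)) = 1" and orth: "\<And>n. \<Phi> n x0 \<bullet> v = 0"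
    and rem: "\<And>n x. norm (\<Phi>'' n x - lin \<gamma> (U x) (\<Phi> n x)) \<le> C * \<epsilon> n"
    by metis
  define K where "K = 8 + 6 * \<gamma>"
  have K: "K \<ge> 0" using \<gamma> by (simp add: K_def)
  have \<Phi>''_le: "norm (\<Phi>'' n x) \<le> K + C" for n x
  proof -
    have "norm (lin \<gamma> (U x) (\<Phi> n x)) \<le> K * norm (\<Phi> n x)"
      unfolding K_def by (rule norm_lin_le[OF \<gamma> norm_U_le])
    also have "\<dots> \<le> K * 1" by (intro mult_left_mono \<Phi>_le K)
    finally have "norm (lin \<gamma> (U x) (\<Phi> n x)) \<le> K" by simp
    moreover have "C * \<epsilon> n \<le> C * 1" by (intro mult_left_mono \<epsilon> C)
    ultimately show ?thesis
      using rem[of n x] norm_triangle_sub[of "\<Phi>'' n x" "lin \<gamma> (U x) (\<Phi> n x)"] by linarith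
  qed
  define B where "B = 2 * 1 + (K + C)"
  have B: "B \<ge> 0" using K C by (simp add: B_def)
  have \<Phi>'_le: "norm (\<Phi>' n x) \<le> B" for n x
    unfolding B_def by (rule norm_derivative_le[OF \<Phi> \<Phi>' \<Phi>_le \<Phi>''_le])
  have \<Phi>_lip: "norm (\<Phi> n y - \<Phi> n x) \<le> B * \<bar>y - x\<bar>" for n x y
    by (rule norm_diff_le_vector_derivative[where S=UNIV, OF \<Phi> \<Phi>'_le]) auto
  have \<Phi>'_lip: "norm (\<Phi>' n y - \<Phi>' n x) \<le> (K + C) * \<bar>y - x\<bar>" for n x y
    by (rule norm_diff_le_vector_derivative[where S=UNIV, OF \<Phi>' \<Phi>''_le]) auto
  \<comment> \<open>The first term comes from the variation of \<open>\<Phi>\<close>, the second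
    from that of the coefficients, where \<open>6 + 2 * \<gamma>\<close> is the Lipschitz constant
    of \<open>U\<close>.\<close>
  define L where "L = K * B + (12 + 12 * \<gamma>) * (6 + 2 * \<gamma>)"
  have L: "L \<ge> 0" using K B \<gamma> by (simp add: L_def)
  have \<Phi>''_osc: "norm (\<Phi>'' n y - \<Phi>'' n x) \<le> L * \<bar>y - x\<bar> + 2 * C * \<epsilon> n" for n x y
  proof -
    have "norm (U y - U x) \<le> (6 + 2 * \<gamma>) * \<bar>y - x\<bar>"
      by (rule norm_diff_le_vector_derivative[where S=UNIV, OF U norm_U'_le]) auto
    then have "norm (lin \<gamma> (U y) (\<Phi> n y) - lin \<gamma> (U x) (\<Phi> n x)) \<le>
        K * (B * \<bar>y - x\<bar>) + (12 + 12 * \<gamma>) * ((6 + 2 * \<gamma>) * \<bar>y - x\<bar>)"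
      using K \<gamma> unfolding K_def
      by (intro order_trans[OF norm_lin_diff_le[OF \<gamma> norm_U_le norm_U_le \<Phi>_le]] add_mono mult_left_mono \<Phi>_lip) auto
    also have "\<dots> = L * \<bar>y - x\<bar>" by (simp add: L_def algebra_simps)
    finally have 1: "norm (lin \<gamma> (U y) (\<Phi> n y) - lin \<gamma> (U x) (\<Phi> n x)) \<le> L * \<bar>y - x\<bar>" .
    have "norm (\<Phi>'' n y - \<Phi>'' n x) \<le> norm (\<Phi>'' n y - lin \<gamma> (U y) (\<Phi> n y))
        + norm (\<Phi>'' n x - lin \<gamma> (U x) (\<Phi> n x)) + norm (lin \<gamma> (U y) (\<Phi> n y) - lin \<gamma> (U x) (\<Phi> n x))"
      by norm
    with 1 rem[of n y] rem[of n x] show ?thesis by linarith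
  qed
  \<comment> \<open>Bundling the functions, the derivatives and the points \<open>t n\<close> makes
    one filter serve all three limits. The last component is independent of \<open>x\<close>, so its
    limit can be read off at 0.\<close>
  have "norm (\<Phi> n x, \<Phi>' n x, t n) \<le> 1 + (B + R)" for n x
    using t(1)[of n] by (intro order_trans[OF norm_Pair_le] add_mono \<Phi>_le \<Phi>'_le) simp
  from bounded_sequence_cluster_filter[of "\<lambda>n x. (\<Phi> n x, \<Phi>' n x, t n)", OF this]
  obtain F g where F: "F \<noteq> bot" "F \<le> sequentially"
    and g: "\<And>x. ((\<lambda>n. (\<Phi> n x, \<Phi>' n x, t n)) \<longlongrightarrow> g x) F" by blast
  define Z where "Z x = fst (g x)" for x
  define Z' where "Z' x = fst (snd (g x))" for x
  define \<tau> where "\<tau> = snd (snd (g 0))"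
  have Z: "((\<lambda>n. \<Phi> n x) \<longlongrightarrow> Z x) F" and Z': "((\<lambda>n. \<Phi>' n x) \<longlongrightarrow> Z' x) F" for x
    using tendsto_fst[OF g[of x]] tendsto_fst[OF tendsto_snd[OF g[of x]]] by (simp_all add: Z_def Z'_def)
  have \<tau>: "(t \<longlongrightarrow> \<tau>) F" using tendsto_snd[OF tendsto_snd[OF g[of 0]]] by (simp add: \<tau>_def)
  have \<epsilon>F: "(\<epsilon> \<longlongrightarrow> 0) F" using \<epsilon>_lim F(2) by (rule tendsto_mono[rotated])
  have \<Phi>''_lim: "((\<lambda>n. \<Phi>'' n x) \<longlongrightarrow> lin \<gamma> (U x) (Z x)) F" for x
  proof -
    have "((\<lambda>n. \<Phi>'' n x - lin \<gamma> (U x) (\<Phi> n x)) \<longlongrightarrow> 0) F"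
    proof (rule Lim_null_comparison)
      show "\<forall>\<^sub>F n in F. norm (\<Phi>'' n x - lin \<gamma> (U x) (\<Phi> n x)) \<le> C * \<epsilon> n" using rem by simp
      show "((\<lambda>n. C * \<epsilon> n) \<longlongrightarrow> 0) F" using tendsto_mult_left[OF \<epsilon>F, of C] by simp
    qed
    from tendsto_add[OF this tendsto_lin[OF Z[of x], of \<gamma> "U x"]] show ?thesis by simp
  qed
  show thesis
  proof (rule that)
    show "(Z has_vector_derivative Z' x) (at x)" for x
      using \<Phi>'_lip K C by (intro has_vector_derivative_limit[OF F(1) Z Z' tendsto_const \<Phi>, where N="K + C"]) auto
    have "((\<lambda>n. 2 * C * \<epsilon> n) \<longlongrightarrow> 0) F" using tendsto_mult_left[OF \<epsilon>F, of "2 * C"] by simp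
    then show "(Z' has_vector_derivative lin \<gamma> (U x) (Z x)) (at x)" for x
      by (intro has_vector_derivative_limit[OF F(1) Z' \<Phi>''_lim _ \<Phi>' \<Phi>''_osc L])
    show "norm (Z x) \<le> 1" for x
      using Lim_norm_ubound[OF F(1) Z] \<Phi>_le by simp
    have "((\<lambda>n. \<Phi> n x0 \<bullet> v) \<longlongrightarrow> Z x0 \<bullet> v) F" by (intro tendsto_intros Z)
    then show "Z x0 \<bullet> v = 0" by (simp add: orth tendsto_const_iff F(1))
    \<comment> \<open>The uniform Lipschitz bound carries the value 1 from the moving point
      \<open>t n\<close> to the fixed point \<open>\<tau>\<close>.\<close>
    have "1 - B * \<bar>t n - \<tau>\<bar> \<le> norm (\<Phi> n \<tau>)" for n
      using \<Phi>_lip[of n "t n" \<tau>] t(2)[of n] norm_triangle_ineq2[of "\<Phi> n (t n)" "\<Phi> n \<tau>"] by linarith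
    moreover have "((\<lambda>n. 1 - B * \<bar>t n - \<tau>\<bar>) \<longlongrightarrow> 1 - B * \<bar>\<tau> - \<tau>\<bar>) F" by (intro tendsto_intros \<tau>)
    moreover have "((\<lambda>n. norm (\<Phi> n \<tau>)) \<longlongrightarrow> norm (Z \<tau>)) F" by (intro tendsto_intros Z)
    ultimately have "1 - B * \<bar>\<tau> - \<tau>\<bar> \<le> norm (Z \<tau>)" by (intro tendsto_le[OF F(1)]) auto
    then show "Z \<tau> \<noteq> 0" by auto
  qed
qed

text \<open>Orthogonality at \<open>x0\<close> removes the freedom of translation, the only kernel
  direction, so a family of distinct pinned solutions tending to \<open>U\<close> uniformly would
  have no admissible linearised limit.\<close>

lemma pinned_rigidity:
  assumes "simple_eigenvalue H2 (L_plus \<gamma> U) 0" and "U' x0 \<noteq> 0"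
  obtains \<epsilon> where "\<epsilon> > 0" "\<And>V V'. (\<And>x. (V has_vector_derivative V' x) (at x)) \<Longrightarrow>
      (\<And>x. (V' has_vector_derivative nonlin \<gamma> (V x)) (at x)) \<Longrightarrow>
      (\<And>x. norm (V x - U x) \<le> \<epsilon>) \<Longrightarrow> (V x0 - U x0) \<bullet> U' x0 = 0 \<Longrightarrow> V = U"
proof (rule ccontr)
  assume "\<not> thesis"
  with that have "\<exists>V V'. (\<forall>x. (V has_vector_derivative V' x) (at x)) \<and>
      (\<forall>x. (V' has_vector_derivative nonlin \<gamma> (V x)) (at x)) \<and>
      (\<forall>x. norm (V x - U x) \<le> \<epsilon>) \<and> (V x0 - U x0) \<bullet> U' x0 = 0 \<and> V \<noteq> U" if "\<epsilon> > 0" for \<epsilon>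
    using \<open>\<epsilon> > 0\<close> by metis
  then show False
  proof (rule linearised_limit)
    fix Z Z' :: "real \<Rightarrow> real \<times> real" and \<tau>
    assume Z: "\<And>x. (Z has_vector_derivative Z' x) (at x)"
      "\<And>x. (Z' has_vector_derivative lin \<gamma> (U x) (Z x)) (at x)"
      "\<And>x. norm (Z x) \<le> 1" "Z x0 \<bullet> U' x0 = 0" "Z \<tau> \<noteq> 0"
    from simple_kernel[OF assms Z(1-4)] Z(5) show False by blast
  qed
qed

text \<open>Otherwise \<open>U\<close> would be constant, against its two different limits.\<close>

lemma exists_nonzero_derivative: "\<exists>x0. U' x0 \<noteq> 0"
proof (rule ccontr)
  assume "\<nexists>x0. U' x0 \<noteq> 0"
  then have "U' x = 0" for x by blast
  then have "norm (U x - U 0) \<le> 0 * \<bar>x - 0\<bar>" for x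
    by (intro norm_diff_le_vector_derivative[where S=UNIV, OF U]) auto
  then have "U = (\<lambda>x. U 0)" by (simp add: fun_eq_iff)
  then have "((\<lambda>x::real. U 0) \<longlongrightarrow> (1, 0)) at_top" "((\<lambda>x::real. U 0) \<longlongrightarrow> (0, 1)) at_bot"
    using U_lims by metis+
  then have "U 0 = (1, 0)" "U 0 = (0, 1)" by (simp_all add: tendsto_const_iff)
  then show False by simp
qed

end

section \<open>From closeness in \<open>L2\<close> to a pinned translate\<close>

theorem proposition5p1:
  fixes \<gamma> :: real and U :: "real \<Rightarrow> real \<times> real"
  assumes "\<gamma> > 1"
    and "energy_minimizing \<gamma> U"
    and "is_solution \<gamma> U"
    and "0 isolated_in spectrum H2 (L_plus \<gamma> U)"
    and "simple_eigenvalue H2 (L_plus \<gamma> U) 0"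
  shows "\<exists>\<eta>\<^sub>0::real. \<eta>\<^sub>0 > 0 \<and>
    (\<forall>V\<in>X_space. is_solution \<gamma> V \<longrightarrow>
       (INF \<tau>::real. norm_L2 (\<lambda>x. U x - V (x - \<tau>))) \<ge> ennreal \<eta>\<^sub>0 \<or>
       (\<exists>\<tau>::real. \<forall>x. V (x - \<tau>) = U x))"
proof -
  have wall: "domain_wall \<gamma> V V'" if "V \<in> X_space" "\<And>x. (V has_vector_derivative V' x) (at x)"
    "\<And>x. (V' has_vector_derivative nonlin \<gamma> (V x)) (at x)" for V V'
    using that assms(1) by (simp add: domain_wall_def X_space_def)
  from assms(3) obtain U' where U': "\<And>x. (U has_vector_derivative U' x) (at x)"
    "\<And>x. (U' has_vector_derivative nonlin \<gamma> (U x)) (at x)"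
    unfolding is_solution_iff by blast
  interpret domain_wall \<gamma> U U'
    using assms(2) U' by (intro wall) (auto simp: energy_minimizing_def)
  from exists_nonzero_derivative obtain x0 where x0: "U' x0 \<noteq> 0" by blast
  from pinned_rigidity[OF assms(5) x0] obtain \<epsilon> where \<epsilon>: "\<epsilon> > 0"
    and rigid: "\<And>V V'. (\<And>x. (V has_vector_derivative V' x) (at x)) \<Longrightarrow>
      (\<And>x. (V' has_vector_derivative nonlin \<gamma> (V x)) (at x)) \<Longrightarrow>
      (\<And>x. norm (V x - U x) \<le> \<epsilon>) \<Longrightarrow> (V x0 - U x0) \<bullet> U' x0 = 0 \<Longrightarrow> V = U" by blast
  define v where "v = U' x0"
  have v: "norm v > 0" using x0 by (simp add: v_def)
  define K where "K = 6 + 2 * \<gamma>"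
  have K: "K > 0" using \<gamma> by (simp add: K_def)
  \<comment> \<open>\<open>g\<close> measures the displacement of \<open>U\<close> along
    \<open>v\<close> near \<open>x0\<close>. Its derivative at 0 is |v|^2 > 0, so it changes sign at
    0, and this persists under small perturbations of \<open>U\<close>.\<close>
  define g where "g s = (U (x0 + s) - U x0) \<bullet> v" for s
  have "((\<lambda>s. U (s + x0)) has_vector_derivative v) (at 0)"
    using has_vector_derivative_translate[OF U, of x0 0] by (simp add: v_def)
  then have "((\<lambda>s. (U (s + x0) - U x0) \<bullet> v) has_vector_derivative v \<bullet> v) (at 0)"
    by (auto intro!: derivative_eq_intros bounded_linear.has_vector_derivative[OF bounded_linear_inner_left])
  then have g: "(g has_real_derivative v \<bullet> v) (at 0)"
    by (simp add: g_def[abs_def] has_real_derivative_iff_has_vector_derivative add.commute)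
  have g0: "g 0 = 0" by (simp add: g_def)
  have vv: "v \<bullet> v > 0" using v by auto
  obtain d1 where d1: "d1 > 0" "\<And>h. 0 < h \<Longrightarrow> h < d1 \<Longrightarrow> g 0 < g (0 + h)"
    using DERIV_pos_inc_right[OF g vv] by blast
  obtain d2 where d2: "d2 > 0" "\<And>h. 0 < h \<Longrightarrow> h < d2 \<Longrightarrow> g (0 - h) < g 0"
    using DERIV_pos_inc_left[OF g vv] by blast
  \<comment> \<open>Small enough for \<open>g\<close> to have opposite signs at
    \<open>\<delta>\<close> and \<open>- \<delta>\<close>, and for a translation by at most
    \<open>\<delta>\<close> to move \<open>U\<close> by at most
    \<open>\<epsilon> / 2\<close>.\<close>
  define \<delta> where "\<delta> = min (min d1 d2) (\<epsilon> / K) / 2"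
  have \<delta>: "0 < \<delta>" "\<delta> < d1" "\<delta> < d2" "K * \<delta> \<le> \<epsilon> / 2"
  proof -
    show "0 < \<delta>" using d1(1) d2(1) \<epsilon> K by (simp add: \<delta>_def)
    have "\<delta> \<le> d1 / 2" "\<delta> \<le> d2 / 2" "\<delta> \<le> \<epsilon> / K / 2" unfolding \<delta>_def by (intro divide_right_mono; simp)+
    then show "\<delta> < d1" "\<delta> < d2" "K * \<delta> \<le> \<epsilon> / 2" using d1(1) d2(1) K by (simp_all add: field_simps)
  qed
  define \<mu> where "\<mu> = min (g \<delta>) (- g (- \<delta>))"
  have \<mu>: "\<mu> > 0" using d1(2)[OF \<delta>(1,2)] d2(2)[OF \<delta>(1,3)] g0 by (simp add: \<mu>_def)
  \<comment> \<open>The first bound leaves \<open>\<epsilon> / 2\<close> for the translation; the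
    second keeps the perturbation of \<open>g\<close> below its margin \<open>\<mu>\<close>.\<close>
  define \<epsilon>1 where "\<epsilon>1 = min (\<epsilon> / 2) (\<mu> / (2 * norm v))"
  have \<epsilon>1: "\<epsilon>1 > 0" "\<epsilon>1 \<le> \<epsilon> / 2" using \<epsilon> \<mu> v by (auto simp: \<epsilon>1_def)
  have "\<epsilon>1 * norm v \<le> \<mu> / (2 * norm v) * norm v" by (intro mult_right_mono) (auto simp: \<epsilon>1_def)
  also have "\<dots> < \<mu>" using v \<mu> by simp
  finally have \<epsilon>1v: "\<epsilon>1 * norm v < \<mu>" .
  \<comment> \<open>\<open>U\<close> and the competitor each have Lipschitz constant
    \<open>K\<close>, their difference \<open>2 * K\<close>; \<open>lipschitz_norm_L2_bound\<close>
    then bounds the cubed distance by \<open>16 * K * \<eta>\<^sup>2\<close>, chosen to be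
    \<open>\<epsilon>1 ^ 3\<close>.\<close>
  define \<eta> where "\<eta> = sqrt (\<epsilon>1 ^ 3 / (16 * K))"
  have \<eta>: "\<eta> > 0" "16 * K * \<eta>\<^sup>2 = \<epsilon>1 ^ 3" using \<epsilon>1 K by (simp_all add: \<eta>_def)
  show ?thesis
  proof (intro exI[of _ \<eta>] conjI ballI impI)
    show "\<eta> > 0" by (rule \<eta>(1))
    fix V assume V: "V \<in> X_space" "is_solution \<gamma> V"
    from V(2) obtain V' where V': "\<And>x. (V has_vector_derivative V' x) (at x)"
      "\<And>x. (V' has_vector_derivative nonlin \<gamma> (V x)) (at x)"
      unfolding is_solution_iff by blast
    interpret V: domain_wall \<gamma> V V' by (rule wall[OF V(1) V'])
    show "(INF \<tau>::real. norm_L2 (\<lambda>x. U x - V (x - \<tau>))) \<ge> ennreal \<eta> \<or> (\<exists>\<tau>::real. \<forall>x. V (x - \<tau>) = U x)"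
    proof (subst disj_commute, rule disjCI)
      assume "\<not> (INF \<tau>::real. norm_L2 (\<lambda>x. U x - V (x - \<tau>))) \<ge> ennreal \<eta>"
      then obtain \<tau> where \<tau>: "norm_L2 (\<lambda>x. U x - V (x - \<tau>)) < ennreal \<eta>"
        by (auto simp: not_le INF_less_iff)
      define V1 where "V1 x = V (x + - \<tau>)" for x
      define V1' where "V1' x = V' (x + - \<tau>)" for x
      have V1: "(V1 has_vector_derivative V1' x) (at x)"
        "(V1' has_vector_derivative nonlin \<gamma> (V1 x)) (at x)" for x
        unfolding V1_def V1'_def
        using has_vector_derivative_translate[OF V'(1)] has_vector_derivative_translate[where f=V', OF V'(2)]
        by blast+
      have "norm (U x - V1 x) ^ 3 \<le> 8 * (2 * K) * \<eta>\<^sup>2" for x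
      proof (rule lipschitz_norm_L2_bound[where D="\<lambda>x. U x - V1 x"])
        show "norm_L2 (\<lambda>x. U x - V1 x) < ennreal \<eta>" using \<tau> by (simp add: V1_def)
        show "norm (U y - V1 y - (U x - V1 x)) \<le> 2 * K * \<bar>y - x\<bar>" for x y
        proof (rule norm_diff_le_vector_derivative[where S=UNIV])
          show "((\<lambda>x. U x - V1 x) has_vector_derivative U' x - V1' x) (at x)" for x
            by (intro has_vector_derivative_diff U V1)
          show "norm (U' x - V1' x) \<le> 2 * K" for x
            using norm_triangle_ineq4[of "U' x" "V1' x"] norm_U'_le[of x] V.norm_U'_le[of "x + - \<tau>"]
            unfolding K_def V1'_def by simp
        qed auto
      qed (use K \<eta> in auto)
      then have "norm (U x - V1 x) ^ 3 \<le> \<epsilon>1 ^ 3" for x using \<eta>(2) by simp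
      then have close: "norm (V1 x - U x) \<le> \<epsilon>1" for x
        using \<epsilon>1(1) by (auto simp: power_mono_iff norm_minus_commute)
      \<comment> \<open>The counterpart of \<open>g\<close> with the competitor in the moving place:
        it stays within \<open>\<mu>\<close> of \<open>g\<close>, hence changes sign on
        \<open>{- \<delta>..\<delta>}\<close>, and at a zero \<open>s\<close> the shifted
        \<open>V1\<close> is pinned at \<open>x0\<close>.\<close>
      define h where "h s = (V1 (x0 + s) - U x0) \<bullet> v" for s
      have hg: "\<bar>h s - g s\<bar> < \<mu>" for s
      proof -
        have "h s - g s = (V1 (x0 + s) - U (x0 + s)) \<bullet> v" by (simp add: h_def g_def inner_diff_left)
        also have "\<bar>\<dots>\<bar> \<le> norm (V1 (x0 + s) - U (x0 + s)) * norm v" by (rule Cauchy_Schwarz_ineq2)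
        also have "\<dots> \<le> \<epsilon>1 * norm v" by (intro mult_right_mono close) simp
        finally show ?thesis using \<epsilon>1v by simp
      qed
      have "h (- \<delta>) \<le> 0" "0 \<le> h \<delta>" using hg[of "- \<delta>"] hg[of \<delta>] by (auto simp: \<mu>_def)
      moreover have "continuous_on {- \<delta>..\<delta>} h"
        unfolding h_def
        by (intro continuous_intros continuous_on_compose2[OF has_vector_derivative_imp_continuous_on[OF V1(1), of UNIV]]) auto
      ultimately obtain s where s: "- \<delta> \<le> s" "s \<le> \<delta>" "h s = 0"
        using IVT'[of h "- \<delta>" 0 \<delta>] \<delta> by auto
      have "(\<lambda>x. V1 (x + s)) = U"
      proof (rule rigid)
        show "((\<lambda>x. V1 (x + s)) has_vector_derivative V1' (x + s)) (at x)"
          "((\<lambda>x. V1' (x + s)) has_vector_derivative nonlin \<gamma> (V1 (x + s))) (at x)" for x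
          using has_vector_derivative_translate[OF V1(1)] has_vector_derivative_translate[where f=V1', OF V1(2)]
          by blast+
        show "(V1 (x0 + s) - U x0) \<bullet> U' x0 = 0" using s(3) by (simp add: h_def v_def)
        fix x
        have "norm (U (x + s) - U x) \<le> K * \<bar>x + s - x\<bar>"
          unfolding K_def by (rule norm_diff_le_vector_derivative[where S=UNIV, OF U norm_U'_le]) auto
        also have "\<dots> \<le> K * \<delta>" using s K by (intro mult_left_mono) auto
        finally have "norm (U (x + s) - U x) \<le> \<epsilon> / 2" using \<delta>(4) by simp
        with close[of "x + s"] \<epsilon>1(2) show "norm (V1 (x + s) - U x) \<le> \<epsilon>"
          using norm_triangle_ineq[of "V1 (x + s) - U (x + s)" "U (x + s) - U x"] by simp
      qed
      then have "V (x - (\<tau> - s)) = U x" for x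
        by (auto simp: V1_def fun_eq_iff algebra_simps)
      then show "\<exists>\<tau>. \<forall>x. V (x - \<tau>) = U x" by blast
    qed
  qed
qed

end
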